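(* Let $0<t\leq\infty$ and let $\overline{n}=(n_1,\dots,n_r)$ be a tuple of non-negative integers with $n_1\leq\cdots\leq n_r$. Then $$\mathrm{TC}(\mathbb{C}\mathrm{P}_{\overline{n}}(t))\leq r\left(1+\mathrm{TC}(\mathbb{C}\mathrm{P}_{(n_1)}(t))\right)-1.$$
   Context: Regard $S^{2m+1}$ as the unit sphere of $\mathbb{C}^{m+1}$. For a positive integer $t$, $\mathbb{Z}_t$ denotes the group of $t$-th roots of unity in $S^1$; by convention $\mathbb{Z}_\infty=S^1$. For $\overline{n}=(n_1,\dots,n_r)$, $$\mathbb{C}\mathrm{P}_{\overline{n}}(t)=\left(S^{2n_1+1}\times\cdots\times S^{2n_r+1}\right)\big/\,(x_1,\dots,x_r)\sim(\lambda x_1,\dots,\lambda x_r),\quad \lambda\in\mathbb{Z}_t.$$ Thus $\mathbb{C}\mathrm{P}_{(n_1)}(\infty)=\mathbb{C}\mathrm{P}^{n_1}$ and, for finite $t$, $\mathbb{C}\mathrm{P}_{(n_1)}(t)$ is the lens space $L^{2n_1+1}(t)$. $\mathrm{TC}(X)$ is Farber's topological complexity in its reduced form: the least integer $k\ge0$ such that $X\times X$ is covered by $k+1$ open sets on each of which the path fibration $X^{[0,1]}\to X\times X$, $\alpha\mapsto(\alpha(0),\alpha(1))$, admits a continuous section (so a contractible space has $\mathrm{TC}=0$). *)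

theory Defs
  imports "HOL-Analysis.Analysis" "HOL-Library.Extended_Nat"
begin

section \<open>Quotient spaces\<close>

definition quotient_topology :: "'a topology \<Rightarrow> ('a \<times> 'a) set \<Rightarrow> 'a set topology" where
  "quotient_topology X R =
     topology (\<lambda>U. U \<subseteq> topspace X // R \<and> openin X {x \<in> topspace X. R `` {x} \<in> U})"

lemma openin_quotient_topology:
  "openin (quotient_topology X R) U \<longleftrightarrow>
     U \<subseteq> topspace X // R \<and> openin X {x \<in> topspace X. R `` {x} \<in> U}"
proof -
  have "istopology (\<lambda>U. U \<subseteq> topspace X // R \<and> openin X {x \<in> topspace X. R `` {x} \<in> U})"
    unfolding istopology_def
  proof (intro conjI allI impI)
    fix S T
    assume S: "S \<subseteq> topspace X // R \<and> openin X {x \<in> topspace X. R `` {x} \<in> S}"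
      and T: "T \<subseteq> topspace X // R \<and> openin X {x \<in> topspace X. R `` {x} \<in> T}"
    show "S \<inter> T \<subseteq> topspace X // R" using S by blast
    have "{x \<in> topspace X. R `` {x} \<in> S \<inter> T} =
            {x \<in> topspace X. R `` {x} \<in> S} \<inter> {x \<in> topspace X. R `` {x} \<in> T}" by blast
    then show "openin X {x \<in> topspace X. R `` {x} \<in> S \<inter> T}"
      using S T by (simp add: openin_Int)
  next
    fix \<K>
    assume K: "\<forall>K\<in>\<K>. K \<subseteq> topspace X // R \<and> openin X {x \<in> topspace X. R `` {x} \<in> K}"
    show "\<Union>\<K> \<subseteq> topspace X // R" using K by blast
    have "{x \<in> topspace X. R `` {x} \<in> \<Union>\<K>} = (\<Union>K\<in>\<K>. {x \<in> topspace X. R `` {x} \<in> K})"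
      by blast
    then show "openin X {x \<in> topspace X. R `` {x} \<in> \<Union>\<K>}"
      using K by (metis (no_types, lifting) openin_Union imageE)
  qed
  then show ?thesis
    by (simp add: quotient_topology_def topology_inverse')
qed

lemma topspace_quotient_topology: "topspace (quotient_topology X R) = topspace X // R"
proof
  show "topspace (quotient_topology X R) \<subseteq> topspace X // R"
    using openin_quotient_topology[of X R "topspace (quotient_topology X R)"] by simp
  have "{x \<in> topspace X. R `` {x} \<in> topspace X // R} = topspace X"
    by (auto intro: quotientI)
  then have "openin (quotient_topology X R) (topspace X // R)"
    by (simp add: openin_quotient_topology)
  then show "topspace X // R \<subseteq> topspace (quotient_topology X R)"
    by (rule openin_subset)
qed

lemma quotient_map_quotient_topology:
  "quotient_map X (quotient_topology X R) (\<lambda>x. R `` {x})"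
  by (auto simp: quotient_map_def topspace_quotient_topology openin_quotient_topology quotient_def)


section \<open>Generalized projective product spaces\<close>

text \<open>The unit sphere \<open>S^(2m+1)\<close> of \<open>\<complex>^(m+1)\<close>; as in \<^const>\<open>nsphere\<close>, a vector of \<open>\<complex>^(m+1)\<close> is a sequence
  vanishing beyond index \<open>m\<close>.\<close>

definition complex_sphere :: "nat \<Rightarrow> (nat \<Rightarrow> complex) topology" where
  "complex_sphere m =
     subtopology (product_topology (\<lambda>_. euclidean) UNIV)
       {z. (\<Sum>j\<le>m. (cmod (z j))\<^sup>2) = 1 \<and> (\<forall>j>m. z j = 0)}"

definition sphere_product :: "nat list \<Rightarrow> (nat \<Rightarrow> nat \<Rightarrow> complex) topology" where
  "sphere_product ns = product_topology (\<lambda>i. complex_sphere (ns ! i)) {..<length ns}"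

definition root_group :: "enat \<Rightarrow> complex set" where
  "root_group t = (case t of enat k \<Rightarrow> {w. cmod w = 1 \<and> w ^ k = 1} | \<infinity> \<Rightarrow> {w. cmod w = 1})"

definition diagonal_orbit_rel ::
    "nat list \<Rightarrow> enat \<Rightarrow> ((nat \<Rightarrow> nat \<Rightarrow> complex) \<times> (nat \<Rightarrow> nat \<Rightarrow> complex)) set" where
  "diagonal_orbit_rel ns t =
     {(x, y). x \<in> topspace (sphere_product ns) \<and> y \<in> topspace (sphere_product ns) \<and>
        (\<exists>w\<in>root_group t. \<forall>i<length ns. \<forall>j. y i j = w * x i j)}"

lemma equiv_diagonal_orbit_rel:
  "equiv (topspace (sphere_product ns)) (diagonal_orbit_rel ns t)"
proof -
  have one: "1 \<in> root_group t"
    by (auto simp: root_group_def split: enat.split)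
  have inv: "inverse w \<in> root_group t" "w \<noteq> 0" if "w \<in> root_group t" for w
    using that by (auto simp: root_group_def norm_inverse power_inverse split: enat.splits)
  have mult: "v * w \<in> root_group t" if "v \<in> root_group t" "w \<in> root_group t" for v w
    using that by (auto simp: root_group_def norm_mult power_mult_distrib split: enat.splits)
  show ?thesis
  proof (rule equivI)
    show "diagonal_orbit_rel ns t \<subseteq> topspace (sphere_product ns) \<times> topspace (sphere_product ns)"
      by (auto simp: diagonal_orbit_rel_def)
    show "refl_on (topspace (sphere_product ns)) (diagonal_orbit_rel ns t)"
      using one by (auto simp: refl_on_def diagonal_orbit_rel_def intro!: bexI[of _ 1])
    show "sym (diagonal_orbit_rel ns t)"
    proof (rule symI)
      fix x y assume "(x, y) \<in> diagonal_orbit_rel ns t"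
      then obtain w where w: "w \<in> root_group t" "\<forall>i<length ns. \<forall>j. y i j = w * x i j"
        and xy: "x \<in> topspace (sphere_product ns)" "y \<in> topspace (sphere_product ns)"
        by (auto simp: diagonal_orbit_rel_def)
      have "\<forall>i<length ns. \<forall>j. x i j = inverse w * y i j"
        using w inv(2)[OF w(1)] by simp
      then show "(y, x) \<in> diagonal_orbit_rel ns t"
        using xy inv(1)[OF w(1)] by (auto simp: diagonal_orbit_rel_def)
    qed
    show "trans (diagonal_orbit_rel ns t)"
    proof (rule transI)
      fix x y z
      assume "(x, y) \<in> diagonal_orbit_rel ns t" "(y, z) \<in> diagonal_orbit_rel ns t"
      then obtain v w where "v \<in> root_group t" "w \<in> root_group t"
        "\<forall>i<length ns. \<forall>j. y i j = v * x i j" "\<forall>i<length ns. \<forall>j. z i j = w * y i j"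
        "x \<in> topspace (sphere_product ns)" "z \<in> topspace (sphere_product ns)"
        by (auto simp: diagonal_orbit_rel_def)
      then show "(x, z) \<in> diagonal_orbit_rel ns t"
        using mult[of w v] by (auto simp: diagonal_orbit_rel_def mult.assoc intro!: bexI[of _ "w * v"])
    qed
  qed
qed

definition CP_space :: "nat list \<Rightarrow> enat \<Rightarrow> (nat \<Rightarrow> nat \<Rightarrow> complex) set topology" where
  "CP_space ns t = quotient_topology (sphere_product ns) (diagonal_orbit_rel ns t)"


section \<open>Topological complexity\<close>

text \<open>Points of \<open>X^[0,1]\<close> are extensional functions on \<open>[0,1]\<close>, so that a path is determined by its
  values there. The topology is the compact-open one.\<close>

definition path_space :: "'a topology \<Rightarrow> (real \<Rightarrow> 'a) topology" where
  "path_space X =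
     topology_generated_by
       {{\<alpha> \<in> extensional {0..1}. pathin X \<alpha> \<and> \<alpha> ` K \<subseteq> U} | K U.
          K \<subseteq> {0..1} \<and> compact K \<and> openin X U}"

lemma topspace_path_space: "topspace (path_space X) = {\<alpha> \<in> extensional {0..1}. pathin X \<alpha>}"
proof -
  have "\<exists>K U. {\<alpha> \<in> extensional {0..1}. pathin X \<alpha>} =
            {\<alpha> \<in> extensional {0..1}. pathin X \<alpha> \<and> \<alpha> ` K \<subseteq> U} \<and>
          K \<subseteq> {0..1::real} \<and> compact K \<and> openin X U"
    by (rule exI[of _ "{}"]) auto
  then show ?thesis
    unfolding path_space_def topology_generated_by_topspace by blast
qed

definition path_fibration :: "(real \<Rightarrow> 'a) \<Rightarrow> 'a \<times> 'a" where
  "path_fibration \<alpha> = (\<alpha> 0, \<alpha> 1)"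

definition has_motion_planner :: "'a topology \<Rightarrow> ('a \<times> 'a) set \<Rightarrow> bool" where
  "has_motion_planner X U \<longleftrightarrow>
     (\<exists>s. continuous_map (subtopology (prod_topology X X) U) (path_space X) s \<and>
          (\<forall>p\<in>U. path_fibration (s p) = p))"

text \<open>The infimum in \<^typ>\<open>enat\<close> is the least element of the set, and \<open>\<infinity>\<close> if the set is empty, that is,
  if there is no finite cover as required.\<close>

definition TC :: "'a topology \<Rightarrow> enat" where
  "TC X =
     Inf {enat k | k. \<exists>U :: nat \<Rightarrow> ('a \<times> 'a) set.
            (\<forall>i\<le>k. openin (prod_topology X X) (U i) \<and> has_motion_planner X (U i)) \<and>
            (\<Union>i\<le>k. U i) = topspace (prod_topology X X)}"

end

theory Submission
  imports Defs
begin

text \<open>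
  Write \<open>P\<close> for the product of the spheres, \<open>G\<close> for the group \<open>\<int>\<^sub>t\<close>, \<open>Q\<close> for \<open>P / G\<close> and \<open>Q\<^sub>1\<close> for the quotient
  of the first sphere. Every open set \<open>U\<close> of \<open>Q\<^sub>1 \<times> Q\<^sub>1\<close> with a motion planner is shown to yield \<open>r\<close> open
  sets of \<open>Q \<times> Q\<close>, each with a motion planner, which together cover the preimage of \<open>U\<close>
  (lemma \<open>refine_motion_planner\<close>). As \<open>1 + TC Q\<^sub>1\<close> sets \<open>U\<close> cover \<open>Q\<^sub>1 \<times> Q\<^sub>1\<close>, the space \<open>Q \<times> Q\<close> is then covered
  by \<open>r (1 + TC Q\<^sub>1)\<close> such sets, and this is the bound.

  To move from \<open>[x]\<close> to \<open>[y]\<close>, take the path from \<open>[x\<^sub>1]\<close> to \<open>[y\<^sub>1]\<close> that the planner on \<open>U\<close> chooses, and lift it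
  to a path in the first sphere starting at \<open>x\<^sub>1\<close>. Its end is \<open>\<phi> y\<^sub>1\<close> for a unique \<open>\<phi> \<in> G\<close>, which depends
  continuously on \<open>(x, y)\<close>. If the representatives \<open>x\<close> and \<open>y\<close> are replaced by \<open>\<lambda> x\<close> and \<open>\<mu> y\<close>, then
  \<open>\<phi> y\<close> becomes \<open>\<lambda> \<phi> y\<close>: the lift has turned the two independent choices of representatives into a single
  one. It remains to join \<open>x\<^sub>i\<close> to \<open>\<phi> y\<^sub>i\<close> for \<open>i \<ge> 2\<close> by a path on an odd sphere which is equivariant under a
  common rotation of both ends. Two rules suffice for one sphere, as an odd sphere has topological
  complexity 1, and the \<open>2 ^ (r - 1)\<close> combinations of rules for \<open>r - 1\<close> spheres can be gathered into \<open>r\<close>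
  open sets.

  Three points need care.

  \<^item> For finite \<open>t\<close> the projection \<open>P \<rightarrow> Q\<close> is a covering and lifts are unique, but for \<open>t = \<infinity>\<close> it is a circle
    bundle, and the lift must be chosen continuously and equivariantly. Both cases are treated in
    the same way: a path is lifted by finitely many small steps, each to the point of the next
    fibre that is nearest to the current point. The step width is a continuous
    function of the path (locale \<open>transport\<close>).

  \<^item> The point \<open>x\<^sub>i\<close> is joined to \<open>\<phi> y\<^sub>i\<close> by the normalization of
    \<open>(1 - \<tau>) x\<^sub>i + \<tau> e\<^bsup>\<i>\<theta>(1 - \<tau>)\<^esup> \<phi> y\<^sub>i\<close>. The choice \<open>\<theta> = 0\<close> fails for antipodal points only, while
    \<open>\<theta> = \<pi>\<close> fails only for \<open>x\<^sub>i = - \<i> \<phi> y\<^sub>i\<close>.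

  \<^item> A real function \<open>g\<^sub>i\<close> measures which of the two rules to prefer. For a cut value \<open>c\<close> different
    from all \<open>g\<^sub>i\<close>, the rule \<open>\<theta> = 0\<close> is used where \<open>g\<^sub>i > c\<close>. The number \<open>k \<in> {0..r - 1}\<close> of indices with
    \<open>g\<^sub>i > c\<close> determines the set of these indices, since they belong to the \<open>k\<close> largest values; so \<open>k\<close> alone
    numbers the \<open>r\<close> open sets.
\<close>

section \<open>Products of open quotient maps\<close>

lemma open_map_prod:
  assumes f: "open_map X X' f" and g: "open_map Y Y' g"
  shows "open_map (prod_topology X Y) (prod_topology X' Y') (\<lambda>p. (f (fst p), g (snd p)))"
proof -
  have "openin (prod_topology X' Y') ((\<lambda>p. (f (fst p), g (snd p))) ` U)"
    if U: "openin (prod_topology X Y) U" for U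
  proof -
    have "\<exists>A B. openin X' A \<and> openin Y' B \<and> f x \<in> A \<and> g y \<in> B \<and>
            A \<times> B \<subseteq> (\<lambda>p. (f (fst p), g (snd p))) ` U" if xy: "(x, y) \<in> U" for x y
    proof -
      obtain A B where AB: "openin X A" "openin Y B" "x \<in> A" "y \<in> B" "A \<times> B \<subseteq> U"
        using U[unfolded openin_prod_topology_alt, rule_format, OF xy] by (elim exE conjE) (rule that)
      have "openin X' (f ` A)" "openin Y' (g ` B)"
        using f g AB(1,2) unfolding open_map_def by blast+
      moreover have "f ` A \<times> g ` B \<subseteq> (\<lambda>p. (f (fst p), g (snd p))) ` U"
      proof
        fix p assume "p \<in> f ` A \<times> g ` B"
        then obtain a b where "a \<in> A" "b \<in> B" "p = (f a, g b)" by blast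
        then show "p \<in> (\<lambda>p. (f (fst p), g (snd p))) ` U"
          using AB(5) by (intro image_eqI[of _ _ "(a, b)"]) auto
      qed
      ultimately show ?thesis using AB(3,4) by (intro exI[of _ "f ` A"] exI[of _ "g ` B"] conjI imageI)
    qed
    then show ?thesis
      unfolding openin_prod_topology_alt by force
  qed
  then show ?thesis by (simp add: open_map_def)
qed

lemma quotient_map_prod_open:
  assumes f: "quotient_map X X' f" "open_map X X' f" and g: "quotient_map Y Y' g" "open_map Y Y' g"
  shows "quotient_map (prod_topology X Y) (prod_topology X' Y') (\<lambda>p. (f (fst p), g (snd p)))"
proof (rule continuous_open_imp_quotient_map)
  show "continuous_map (prod_topology X Y) (prod_topology X' Y') (\<lambda>p. (f (fst p), g (snd p)))"
    using continuous_map_compose[OF continuous_map_fst quotient_imp_continuous_map[OF f(1)]]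
      continuous_map_compose[OF continuous_map_snd quotient_imp_continuous_map[OF g(1)]]
    by (intro continuous_map_pairedI) (simp_all add: o_def)
  show "open_map (prod_topology X Y) (prod_topology X' Y') (\<lambda>p. (f (fst p), g (snd p)))"
    by (rule open_map_prod[OF f(2) g(2)])
  have "f ` topspace X = topspace X'" "g ` topspace Y = topspace Y'"
    using f(1) g(1) by (simp_all add: quotient_imp_surjective_map)
  then show "(\<lambda>p. (f (fst p), g (snd p))) ` topspace (prod_topology X Y) = topspace (prod_topology X' Y')"
    using image_paired_Times[of f g "topspace X" "topspace Y"] by (simp add: case_prod_unfold)
qed

lemma continuous_map_unary_op:
  assumes "continuous_map Z euclidean f" and "continuous_on S h" and "\<And>z. z \<in> topspace Z \<Longrightarrow> f z \<in> S"
  shows "continuous_map Z euclidean (\<lambda>z. h (f z))"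
proof -
  have "continuous_map Z (top_of_set S) f"
    using assms by (auto simp: continuous_map_in_subtopology)
  then show ?thesis
    using continuous_map_compose[of Z "top_of_set S" f euclidean h] assms(2) by (simp add: o_def)
qed

lemma continuous_map_binary_op:
  fixes h :: "'a::topological_space \<Rightarrow> 'b::topological_space \<Rightarrow> 'c::topological_space"
  assumes "continuous_map Z euclidean f" and "continuous_map Z euclidean g"
    and "continuous_on S (\<lambda>p. h (fst p) (snd p))"
    and "\<And>z. z \<in> topspace Z \<Longrightarrow> (f z, g z) \<in> S"
  shows "continuous_map Z euclidean (\<lambda>z. h (f z) (g z))"
proof -
  have "continuous_map Z (top_of_set S) (\<lambda>z. (f z, g z))"
    using continuous_map_pairedI[OF assms(1,2)] assms(4)
    by (auto simp: continuous_map_in_subtopology)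
  then have "continuous_map Z euclidean ((\<lambda>p. h (fst p) (snd p)) \<circ> (\<lambda>z. (f z, g z)))"
    using continuous_map_compose[of Z "top_of_set S" _ euclidean "\<lambda>p. h (fst p) (snd p)"] assms(3) by simp
  then show ?thesis unfolding o_def fst_conv snd_conv .
qed

lemma continuous_map_complex_mult:
  fixes f g :: "'z \<Rightarrow> complex"
  assumes "continuous_map Z euclidean f" and "continuous_map Z euclidean g"
  shows "continuous_map Z euclidean (\<lambda>z. f z * g z)"
  by (rule continuous_map_binary_op[OF assms, of UNIV]) (auto intro!: continuous_intros)

section \<open>Path spaces\<close>

text \<open>One half of the exponential law: continuity into the compact-open topology is the tube lemma.\<close>

lemma continuous_map_into_path_space:
  assumes h: "continuous_map (prod_topology Z (top_of_set {0..1})) X (\<lambda>p. h (fst p) (snd p))"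
  shows "continuous_map Z (path_space X) (\<lambda>z. restrict (h z) {0..1})"
proof -
  have path: "pathin X (restrict (h z) {0..1})" if z: "z \<in> topspace Z" for z
  proof -
    have "continuous_map (top_of_set {0..1}) (prod_topology Z (top_of_set {0..1::real})) (\<lambda>\<tau>. (z, \<tau>))"
      using z by (intro continuous_map_pairedI) auto
    from continuous_map_compose[OF this h]
    have "continuous_map (top_of_set {0..1}) X (h z)" by (simp add: o_def)
    then show ?thesis unfolding pathin_def
      by (rule continuous_map_eq) auto
  qed
  show ?thesis
    unfolding path_space_def
  proof (rule continuous_on_generated_topo)
    fix N assume "N \<in> {{\<alpha> \<in> extensional {0..1}. pathin X \<alpha> \<and> \<alpha> ` K \<subseteq> U} |K U.
          K \<subseteq> {0..1::real} \<and> compact K \<and> openin X U}"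
    then obtain K U where N: "N = {\<alpha> \<in> extensional {0..1}. pathin X \<alpha> \<and> \<alpha> ` K \<subseteq> U}"
      and K: "K \<subseteq> {0..1}" "compact K" and U: "openin X U" by auto
    define W where "W = {p \<in> topspace (prod_topology Z (top_of_set {0..1})). h (fst p) (snd p) \<in> U}"
    have W: "openin (prod_topology Z (top_of_set {0..1})) W"
      unfolding W_def by (rule openin_continuous_map_preimage[OF h U])
    have KI: "compactin (top_of_set {0..1}) K"
      using K by (simp add: compactin_subtopology)
    have eq: "(\<lambda>z. restrict (h z) {0..1}) -` N \<inter> topspace Z = {z \<in> topspace Z. {z} \<times> K \<subseteq> W}"
      using K(1) path by (auto simp: N W_def subset_iff image_subset_iff)
    have "\<exists>V. openin Z V \<and> z \<in> V \<and> V \<subseteq> {z \<in> topspace Z. {z} \<times> K \<subseteq> W}"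
      if z: "z \<in> topspace Z" "{z} \<times> K \<subseteq> W" for z
    proof -
      obtain V V' where "openin Z V" "openin (top_of_set {0..1}) V'" "z \<in> V" "K \<subseteq> V'" "V \<times> V' \<subseteq> W"
        using tube_lemma_right[OF W KI z(1) z(2)] by blast
      moreover have "V \<subseteq> topspace Z" using \<open>openin Z V\<close> by (rule openin_subset)
      ultimately show ?thesis by (intro exI[of _ V]) blast
    qed
    then show "openin Z ((\<lambda>z. restrict (h z) {0..1}) -` N \<inter> topspace Z)"
      unfolding eq by (subst openin_subopen) blast
  next
    have "\<exists>K U. {\<alpha> \<in> extensional {0..1}. pathin X \<alpha>} =
            {\<alpha> \<in> extensional {0..1}. pathin X \<alpha> \<and> \<alpha> ` K \<subseteq> U} \<and>
          K \<subseteq> {0..1::real} \<and> compact K \<and> openin X U"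
      by (rule exI[of _ "{}"]) auto
    moreover have "(\<lambda>z. restrict (h z) {0..1}) ` topspace Z \<subseteq> {\<alpha> \<in> extensional {0..1}. pathin X \<alpha>}"
      using path by auto
    ultimately show "(\<lambda>z. restrict (h z) {0..1}) ` topspace Z \<subseteq>
      \<Union> {{\<alpha> \<in> extensional {0..1}. pathin X \<alpha> \<and> \<alpha> ` K \<subseteq> U} |K U.
          K \<subseteq> {0..1::real} \<and> compact K \<and> openin X U}"
      by blast
  qed
qed

text \<open>The other half of the exponential law. It rests on local compactness of the interval: a point has a compact
neighbourhood that a given path maps into a given open set.\<close>

lemma continuous_map_eval_path_space:
  assumes s: "continuous_map Z (path_space X) s"
  shows "continuous_map (prod_topology Z (top_of_set {0..1})) X (\<lambda>p. s (fst p) (snd p))"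
proof -
  have path: "continuous_map (top_of_set {0..1}) X (s z)" if "z \<in> topspace Z" for z
    using continuous_map_image_subset_topspace[OF s] that
    by (auto simp: topspace_path_space pathin_def)
  show ?thesis
    unfolding continuous_map_def
  proof (intro conjI allI impI)
    show "(\<lambda>p. s (fst p) (snd p)) \<in> topspace (prod_topology Z (top_of_set {0..1})) \<rightarrow> topspace X"
      using continuous_map_image_subset_topspace[OF path] by fastforce
  next
    fix U assume U: "openin X U"
    define W where "W = {p \<in> topspace (prod_topology Z (top_of_set {0..1})). s (fst p) (snd p) \<in> U}"
    have "\<exists>A B. openin Z A \<and> openin (top_of_set {0..1}) B \<and> z \<in> A \<and> \<tau> \<in> B \<and> A \<times> B \<subseteq> W"
      if "(z, \<tau>) \<in> W" for z \<tau>
    proof -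
      have z: "z \<in> topspace Z" and \<tau>: "\<tau> \<in> {0..1}" "s z \<tau> \<in> U" using that by (auto simp: W_def)
      have "openin (top_of_set {0..1}) {\<sigma> \<in> {0..1}. s z \<sigma> \<in> U}"
        using openin_continuous_map_preimage[OF path[OF z] U] by simp
      then obtain e where e: "e > 0" "cball \<tau> e \<inter> {0..1} \<subseteq> {\<sigma> \<in> {0..1}. s z \<sigma> \<in> U}"
        using \<tau> by (auto simp: openin_contains_cball)
      define K where "K = cball \<tau> e \<inter> {0..1}"
      define N where "N = {\<alpha> \<in> extensional {0..1}. pathin X \<alpha> \<and> \<alpha> ` K \<subseteq> U}"
      have "compact K" by (simp add: K_def compact_Int)
      then have N: "openin (path_space X) N"
        unfolding path_space_def N_def using U
        by (intro topology_generated_by_Basis CollectI exI[of _ K] exI[of _ U]) (auto simp: K_def)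
      define A where "A = {z \<in> topspace Z. s z \<in> N}"
      have "openin Z A"
        unfolding A_def by (rule openin_continuous_map_preimage[OF s N])
      moreover have "z \<in> A"
        using e z continuous_map_image_subset_topspace[OF s]
        by (auto simp: A_def N_def K_def topspace_path_space)
      moreover have "openin (top_of_set {0..1}) ({0..1} \<inter> ball \<tau> e)"
        by (simp add: openin_open_Int)
      moreover have "\<tau> \<in> {0..1} \<inter> ball \<tau> e" using \<tau> e by simp
      moreover have "A \<times> ({0..1} \<inter> ball \<tau> e) \<subseteq> W"
        by (auto simp: A_def N_def K_def W_def image_subset_iff)
      ultimately show ?thesis by blast
    qed
    then show "openin (prod_topology Z (top_of_set {0..1}))
        {p \<in> topspace (prod_topology Z (top_of_set {0..1})). s (fst p) (snd p) \<in> U}"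
      unfolding W_def[symmetric] openin_prod_topology_alt by blast
  qed
qed

section \<open>Infima over a compact factor\<close>

lemma compact_space_attains_Inf:
  fixes f :: "'k \<Rightarrow> real"
  assumes "compact_space K" and "topspace K \<noteq> {}" and "continuous_map K euclideanreal f"
  shows "\<exists>k\<in>topspace K. Inf (f ` topspace K) = f k"
    and "\<And>k. k \<in> topspace K \<Longrightarrow> Inf (f ` topspace K) \<le> f k"
proof -
  have c: "compact (f ` topspace K)"
    using image_compactin[OF _ assms(3)] assms(1) by (auto simp: compact_space_def)
  show "\<exists>k\<in>topspace K. Inf (f ` topspace K) = f k"
    using closed_contains_Inf[of "f ` topspace K"] c assms(2)
    by (auto simp: compact_imp_closed bounded_imp_bdd_below compact_imp_bounded image_iff)
  show "\<And>k. k \<in> topspace K \<Longrightarrow> Inf (f ` topspace K) \<le> f k"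
    using c by (intro cInf_lower) (auto simp: bounded_imp_bdd_below compact_imp_bounded)
qed

text \<open>The infimum is lower semicontinuous by the tube lemma, as it is attained on a compact factor, and upper
semicontinuous because the projection of an open set is open.\<close>

lemma continuous_map_Inf_compact:
  fixes f :: "'z \<Rightarrow> 'k \<Rightarrow> real"
  assumes K: "compact_space K" "topspace K \<noteq> {}"
    and f: "continuous_map (prod_topology Z K) euclideanreal (\<lambda>p. f (fst p) (snd p))"
  shows "continuous_map Z euclideanreal (\<lambda>z. Inf (f z ` topspace K))"
proof -
  have fz: "continuous_map K euclideanreal (f z)" if z: "z \<in> topspace Z" for z
  proof -
    have "continuous_map K (prod_topology Z K) (\<lambda>k. (z, k))"
      using z by (intro continuous_map_pairedI) auto
    from continuous_map_compose[OF this f] show ?thesis by (simp add: o_def)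
  qed
  note att = compact_space_attains_Inf[OF K fz]
  have lower: "openin Z {z \<in> topspace Z. a < Inf (f z ` topspace K)}" for a
  proof -
    define W where "W = {p \<in> topspace (prod_topology Z K). f (fst p) (snd p) \<in> {a<..}}"
    have W: "openin (prod_topology Z K) W"
      unfolding W_def by (rule openin_continuous_map_preimage[OF f]) (simp flip: open_openin)
    have eq: "{z \<in> topspace Z. a < Inf (f z ` topspace K)} = {z \<in> topspace Z. {z} \<times> topspace K \<subseteq> W}"
    proof (rule Collect_cong, rule conj_cong[OF refl])
      fix z assume z: "z \<in> topspace Z"
      show "(a < Inf (f z ` topspace K)) = ({z} \<times> topspace K \<subseteq> W)"
      proof
        assume "a < Inf (f z ` topspace K)"
        then show "{z} \<times> topspace K \<subseteq> W"
          using att(2)[OF z] z by (auto simp: W_def intro: less_le_trans)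
      next
        assume W: "{z} \<times> topspace K \<subseteq> W"
        obtain k where "k \<in> topspace K" "Inf (f z ` topspace K) = f z k" using att(1)[OF z] by blast
        then show "a < Inf (f z ` topspace K)" using W by (auto simp: W_def)
      qed
    qed
    have "\<exists>V. openin Z V \<and> z \<in> V \<and> V \<subseteq> {z \<in> topspace Z. {z} \<times> topspace K \<subseteq> W}"
      if z: "z \<in> topspace Z" "{z} \<times> topspace K \<subseteq> W" for z
    proof -
      obtain V V' where "openin Z V" "openin K V'" "z \<in> V" "topspace K \<subseteq> V'" "V \<times> V' \<subseteq> W"
        using tube_lemma_right[OF W _ z(1) z(2)] K(1) by (auto simp: compact_space_def)
      moreover have "V \<subseteq> topspace Z" using \<open>openin Z V\<close> by (rule openin_subset)
      ultimately show ?thesis by (intro exI[of _ V]) blast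
    qed
    then show ?thesis
      unfolding eq by (subst openin_subopen) blast
  qed
  have upper: "openin Z {z \<in> topspace Z. Inf (f z ` topspace K) < a}" for a
  proof -
    define W where "W = {p \<in> topspace (prod_topology Z K). f (fst p) (snd p) \<in> {..<a}}"
    have W: "openin (prod_topology Z K) W"
      unfolding W_def by (rule openin_continuous_map_preimage[OF f]) (simp flip: open_openin)
    have "{z \<in> topspace Z. Inf (f z ` topspace K) < a} = fst ` W"
    proof (intro equalityI subsetI)
      fix z assume "z \<in> {z \<in> topspace Z. Inf (f z ` topspace K) < a}"
      then have z: "z \<in> topspace Z" "Inf (f z ` topspace K) < a" by auto
      obtain k where "k \<in> topspace K" "Inf (f z ` topspace K) = f z k" using att(1)[OF z(1)] by blast
      then show "z \<in> fst ` W" using z by (intro image_eqI[of _ _ "(z, k)"]) (auto simp: W_def)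
    next
      fix z assume "z \<in> fst ` W"
      then obtain k where k: "z \<in> topspace Z" "k \<in> topspace K" "f z k < a" by (auto simp: W_def)
      then show "z \<in> {z \<in> topspace Z. Inf (f z ` topspace K) < a}"
        using att(2)[OF k(1,2)] by auto
    qed
    then show ?thesis using open_map_fst[of Z K] W unfolding open_map_def by presburger
  qed
  show ?thesis
    unfolding continuous_map_upper_lower_semicontinuous_lt using lower upper by blast
qed


section \<open>Motion planners on open quotients\<close>

text \<open>A rule \<open>h\<close> for pairs of representatives defines a motion planner on a quotient as soon as it does not depend on the
representatives: the path of a pair of classes is read off from an arbitrary pair of representatives, and this is
continuous because the product of two open quotient maps is again a quotient map.\<close>

lemma motion_planner_descends:
  fixes h :: "'x \<times> 'x \<Rightarrow> real \<Rightarrow> 'q"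
  assumes q: "quotient_map X Q q" "open_map X Q q"
    and W: "openin (prod_topology X X) W"
    and h: "continuous_map (prod_topology (subtopology (prod_topology X X) W) (top_of_set {0..1})) Q
              (\<lambda>p. h (fst p) (snd p))"
    and ends: "\<And>x y. (x, y) \<in> W \<Longrightarrow> h (x, y) 0 = q x \<and> h (x, y) 1 = q y"
    and inv: "\<And>x y x' y'. \<lbrakk>(x, y) \<in> W; x' \<in> topspace X; y' \<in> topspace X; q x' = q x; q y' = q y\<rbrakk>
                \<Longrightarrow> (x', y') \<in> W \<and> (\<forall>\<tau>\<in>{0..1}. h (x', y') \<tau> = h (x, y) \<tau>)"
  shows "openin (prod_topology Q Q) ((\<lambda>p. (q (fst p), q (snd p))) ` W)"
    and "has_motion_planner Q ((\<lambda>p. (q (fst p), q (snd p))) ` W)"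
proof -
  let ?\<pi> = "\<lambda>p. (q (fst p), q (snd p))"
  have WX: "W \<subseteq> topspace X \<times> topspace X" using openin_subset[OF W] by simp
  have eq: "{p \<in> topspace (prod_topology X X). ?\<pi> p \<in> ?\<pi> ` W} = W"
  proof (intro equalityI subsetI)
    fix p assume "p \<in> {p \<in> topspace (prod_topology X X). ?\<pi> p \<in> ?\<pi> ` W}"
    then obtain v where v: "v \<in> W" "?\<pi> p = ?\<pi> v" and p: "fst p \<in> topspace X" "snd p \<in> topspace X" by auto
    then show "p \<in> W" using inv[of "fst v" "snd v" "fst p" "snd p"] by simp
  qed (use WX in auto)
  show op: "openin (prod_topology Q Q) (?\<pi> ` W)"
    using open_map_prod[OF q(2) q(2)] W by (auto simp: open_map_def)
  have quoW: "quotient_map (subtopology (prod_topology X X) W) (subtopology (prod_topology Q Q) (?\<pi> ` W)) ?\<pi>"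
    by (rule quotient_map_restriction[OF quotient_map_prod_open[OF q q] eq disjI1[OF op]])
  define s where "s c = restrict (h (SOME p. p \<in> W \<and> ?\<pi> p = c)) {0..1}" for c
  have s: "s (?\<pi> p) = restrict (h p) {0..1}" if p: "p \<in> W" for p
  proof -
    define v where "v = (SOME v. v \<in> W \<and> ?\<pi> v = ?\<pi> p)"
    have "v \<in> W \<and> ?\<pi> v = ?\<pi> p" unfolding v_def by (rule someI[of _ p]) (simp add: p)
    then have "\<forall>\<tau>\<in>{0..1}. h (fst v, snd v) \<tau> = h (fst p, snd p) \<tau>"
      using inv[of "fst p" "snd p" "fst v" "snd v"] p WX by auto
    then show ?thesis unfolding s_def v_def[symmetric] by (intro restrict_ext) simp
  qed
  have "continuous_map (subtopology (prod_topology X X) W) (path_space Q) (s \<circ> ?\<pi>)"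
    by (rule continuous_map_eq[OF continuous_map_into_path_space[OF h]]) (simp add: s)
  from continuous_compose_quotient_map[OF quoW this]
  have "continuous_map (subtopology (prod_topology Q Q) (?\<pi> ` W)) (path_space Q) s" .
  moreover have "path_fibration (s c) = c" if c: "c \<in> ?\<pi> ` W" for c
  proof -
    obtain p where p: "p \<in> W" "c = ?\<pi> p" using c by blast
    then show ?thesis using s[OF p(1)] ends[of "fst p" "snd p"] by (simp add: path_fibration_def)
  qed
  ultimately show "has_motion_planner Q (?\<pi> ` W)" unfolding has_motion_planner_def by blast
qed


text \<open>A finite infimum is a minimum, so a finite value of \<open>TC\<close> comes with a cover that realizes it.\<close>

lemma TC_attained:
  assumes "TC X = enat m"
  obtains U where "\<And>i. i \<le> m \<Longrightarrow> openin (prod_topology X X) (U i) \<and> has_motion_planner X (U i)"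
    and "(\<Union>i\<le>m. U i) = topspace (prod_topology X X)"
proof -
  let ?S = "{enat k | k. \<exists>U :: nat \<Rightarrow> ('a \<times> 'a) set.
            (\<forall>i\<le>k. openin (prod_topology X X) (U i) \<and> has_motion_planner X (U i)) \<and>
            (\<Union>i\<le>k. U i) = topspace (prod_topology X X)}"
  have "?S \<noteq> {}"
  proof
    assume "?S = {}"
    then have "TC X = Inf {}" unfolding TC_def by (rule arg_cong)
    then show False using assms by (simp add: Inf_enat_def)
  qed
  then have "Inf ?S \<in> ?S" by (meson ex_in_conv wellorder_InfI)
  then have "enat m \<in> ?S" using assms unfolding TC_def by (rule back_subst[of "\<lambda>k. k \<in> ?S"])
  then show ?thesis using that by blast
qed

section \<open>Lifting paths by small steps\<close>

text \<open>The map \<open>q\<close> is to be thought of as a bundle with a partially defined connection: \<open>T z c\<close> is a point of the fibre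
over \<open>c\<close> obtained from \<open>z\<close>, and it is available if \<open>c\<close> is close enough to \<open>q z\<close>. Closeness is expressed by
positivity of a continuous function \<open>F\<close>, instead of by membership in a neighbourhood of the diagonal, because a
step width that works for a given path can then be computed from \<open>F\<close>.\<close>

locale transport =
  fixes X :: "'x topology" and Q :: "'q topology" and q :: "'x \<Rightarrow> 'q"
    and F :: "'q \<Rightarrow> 'q \<Rightarrow> real" and T :: "'x \<Rightarrow> 'q \<Rightarrow> 'x"
  assumes q_cont: "continuous_map X Q q"
    and F_cont: "continuous_map (prod_topology Q Q) euclideanreal (\<lambda>p. F (fst p) (snd p))"
    and F_nonneg: "\<And>c d. \<lbrakk>c \<in> topspace Q; d \<in> topspace Q\<rbrakk> \<Longrightarrow> 0 \<le> F c d"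
    and F_diag: "\<And>c. c \<in> topspace Q \<Longrightarrow> 0 < F c c"
    and T_cont: "continuous_map (subtopology (prod_topology X Q) {p. 0 < F (q (fst p)) (snd p)}) X
                   (\<lambda>p. T (fst p) (snd p))"
    and q_T: "\<And>z c. \<lbrakk>z \<in> topspace X; c \<in> topspace Q; 0 < F (q z) c\<rbrakk> \<Longrightarrow> q (T z c) = c"
    and T_id: "\<And>z. z \<in> topspace X \<Longrightarrow> T z (q z) = z"
begin

lemma T_in: "T z c \<in> topspace X" if "z \<in> topspace X" "c \<in> topspace Q" "0 < F (q z) c"
  using continuous_map_image_subset_topspace[OF T_cont] that
  by (force simp: image_subset_iff)

text \<open>A step width for lifting \<open>\<alpha>\<close>. If \<open>a\<close> and \<open>b\<close> are at most \<open>mesh \<alpha>\<close> apart, then \<open>F (\<alpha> a) (\<alpha> b) \<ge> mesh \<alpha> > 0\<close>, so \<open>\<alpha> b\<close>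
can be reached from the fibre over \<open>\<alpha> a\<close>. Adding \<open>\<bar>a - b\<bar>\<close> to \<open>F\<close> and minimizing over the whole square makes this width
positive and continuous in \<open>\<alpha>\<close>.\<close>

definition mesh :: "(real \<Rightarrow> 'q) \<Rightarrow> real" where
  "mesh \<alpha> = Inf ((\<lambda>p. (\<bar>fst p - snd p\<bar> + F (\<alpha> (fst p)) (\<alpha> (snd p))) / 2) ` ({0..1} \<times> {0..1}))"

text \<open>The lift at time \<open>\<tau>\<close> runs through the times \<open>mesh \<alpha>, 2 * mesh \<alpha>, \<dots>\<close> truncated at \<open>\<tau>\<close>. Truncation makes all steps
from some index on trivial, and this is what makes the lift continuous although the number of steps jumps with the path.\<close>

primrec lift_step :: "'x \<Rightarrow> (real \<Rightarrow> 'q) \<Rightarrow> real \<Rightarrow> nat \<Rightarrow> 'x" where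
  "lift_step z \<alpha> \<tau> 0 = z"
| "lift_step z \<alpha> \<tau> (Suc k) = T (lift_step z \<alpha> \<tau> k) (\<alpha> (min \<tau> (real (Suc k) * mesh \<alpha>)))"

definition lift :: "'x \<Rightarrow> (real \<Rightarrow> 'q) \<Rightarrow> real \<Rightarrow> 'x" where
  "lift z \<alpha> \<tau> = lift_step z \<alpha> \<tau> (nat \<lceil>1 / mesh \<alpha>\<rceil>)"

abbreviation square :: "(real \<times> real) topology" where
  "square \<equiv> top_of_set ({0..1} \<times> {0..1})"

lemma compact_space_square: "compact_space square"
  by (simp add: compact_space_subtopology compact_Times)

lemma continuous_map_mesh_integrand:
  assumes "continuous_map (prod_topology Z (top_of_set {0..1})) Q (\<lambda>p. H (fst p) (snd p))"
  shows "continuous_map (prod_topology Z square) euclideanreal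
           (\<lambda>p. (\<bar>fst (snd p) - snd (snd p)\<bar> + F (H (fst p) (fst (snd p))) (H (fst p) (snd (snd p)))) / 2)"
proof -
  let ?P = "prod_topology Z square"
  have f: "continuous_map ?P Z fst" by (rule continuous_map_fst)
  have s: "continuous_map ?P (top_of_set {0..1}) (\<lambda>p. fst (snd p))"
    "continuous_map ?P (top_of_set {0..1}) (\<lambda>p. snd (snd p))"
  proof -
    have "continuous_map square (top_of_set {0..1}) fst" "continuous_map square (top_of_set {0..1}) snd"
      by (auto simp: continuous_map_in_subtopology continuous_on_fst continuous_on_snd)
    from this[THEN continuous_map_compose[OF continuous_map_snd]]
    show "continuous_map ?P (top_of_set {0..1}) (\<lambda>p. fst (snd p))"
      "continuous_map ?P (top_of_set {0..1}) (\<lambda>p. snd (snd p))"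
      by (simp_all add: o_def)
  qed
  then have r: "continuous_map ?P euclideanreal (\<lambda>p. fst (snd p))"
    "continuous_map ?P euclideanreal (\<lambda>p. snd (snd p))"
    by (simp_all add: continuous_map_in_subtopology)
  have H: "continuous_map ?P Q (\<lambda>p. H (fst p) (fst (snd p)))"
    "continuous_map ?P Q (\<lambda>p. H (fst p) (snd (snd p)))"
    using continuous_map_compose[OF continuous_map_pairedI[OF f s(1)] assms]
      continuous_map_compose[OF continuous_map_pairedI[OF f s(2)] assms]
    by (simp_all add: o_def)
  have "continuous_map ?P euclideanreal (\<lambda>p. F (H (fst p) (fst (snd p))) (H (fst p) (snd (snd p))))"
    using continuous_map_compose[OF continuous_map_pairedI[OF H] F_cont] by (simp add: o_def)
  then show ?thesis
    by (intro continuous_intros r) auto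
qed

lemma continuous_map_mesh:
  assumes "continuous_map (prod_topology Z (top_of_set {0..1})) Q (\<lambda>p. H (fst p) (snd p))"
  shows "continuous_map Z euclideanreal (\<lambda>z. mesh (H z))"
  using continuous_map_Inf_compact[OF compact_space_square _ continuous_map_mesh_integrand[OF assms]]
  by (simp add: mesh_def)

lemma
  assumes "pathin Q \<alpha>"
  shows mesh_pos: "0 < mesh \<alpha>"
    and mesh_le: "\<And>a b. \<lbrakk>a \<in> {0..1}; b \<in> {0..1}\<rbrakk> \<Longrightarrow> 2 * mesh \<alpha> \<le> \<bar>a - b\<bar> + F (\<alpha> a) (\<alpha> b)"
proof -
  have \<alpha>: "\<alpha> a \<in> topspace Q" if "a \<in> {0..1}" for a
    using continuous_map_image_subset_topspace[OF assms[unfolded pathin_def]] that by auto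
  have "continuous_map (prod_topology (top_of_set {0::real}) (top_of_set {0..1::real})) Q (\<lambda>p. \<alpha> (snd p :: real))"
    using continuous_map_compose[OF continuous_map_snd assms[unfolded pathin_def]] unfolding o_def .
  from continuous_map_mesh_integrand[OF this]
  have c: "continuous_map (prod_topology (top_of_set {0::real}) square) euclideanreal
     (\<lambda>p. (\<bar>fst (snd p) - snd (snd p)\<bar> + F (\<alpha> (fst (snd p))) (\<alpha> (snd (snd p)))) / 2)" .
  have "continuous_map square (prod_topology (top_of_set {0::real}) square) (\<lambda>p. (0, p))"
    by (intro continuous_map_pairedI) auto
  from continuous_map_compose[OF this c]
  have c: "continuous_map square euclideanreal
      (\<lambda>p. (\<bar>fst p - snd p\<bar> + F (\<alpha> (fst p)) (\<alpha> (snd p))) / 2)" by (simp add: o_def)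
  have ne: "topspace square \<noteq> {}" by simp
  note att = compact_space_attains_Inf[OF compact_space_square ne c]
  obtain a b where ab: "a \<in> {0..1}" "b \<in> {0..1}" "mesh \<alpha> = (\<bar>a - b\<bar> + F (\<alpha> a) (\<alpha> b)) / 2"
    using att(1) by (auto simp: mesh_def)
  show "0 < mesh \<alpha>"
  proof (cases "a = b")
    case True then show ?thesis using ab F_diag[OF \<alpha>[OF ab(2)]] by simp
  next
    case False then show ?thesis
      using ab F_nonneg[OF \<alpha> \<alpha>] unfolding ab(3) by (intro divide_pos_pos add_pos_nonneg) auto
  qed
  show "2 * mesh \<alpha> \<le> \<bar>a - b\<bar> + F (\<alpha> a) (\<alpha> b)" if "a \<in> {0..1}" "b \<in> {0..1}" for a b
    using att(2)[of "(a, b)"] that by (simp add: mesh_def)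
qed

lemma lift_step_admissible:
  assumes \<alpha>: "pathin Q \<alpha>" and \<tau>: "\<tau> \<in> {0..1}"
  shows "0 < F (\<alpha> (min \<tau> (real k * mesh \<alpha>))) (\<alpha> (min \<tau> (real (Suc k) * mesh \<alpha>)))"
proof -
  let ?a = "min \<tau> (real k * mesh \<alpha>)" and ?b = "min \<tau> (real (Suc k) * mesh \<alpha>)"
  have m: "0 < mesh \<alpha>" using mesh_pos[OF \<alpha>] .
  have s: "real (Suc k) * mesh \<alpha> = real k * mesh \<alpha> + mesh \<alpha>" by (simp add: algebra_simps)
  have "0 \<le> real k * mesh \<alpha>" using m by simp
  then have "?a \<in> {0..1}" "?b \<in> {0..1}" "\<bar>?a - ?b\<bar> \<le> mesh \<alpha>"
    using \<tau> m unfolding s by (auto simp: min_def)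
  then show ?thesis using mesh_le[OF \<alpha>, of ?a ?b] m by linarith
qed

lemma lift_step_over:
  assumes \<alpha>: "pathin Q \<alpha>" and \<tau>: "\<tau> \<in> {0..1}" and z: "z \<in> topspace X" "q z = \<alpha> 0"
  shows "lift_step z \<alpha> \<tau> k \<in> topspace X \<and> q (lift_step z \<alpha> \<tau> k) = \<alpha> (min \<tau> (real k * mesh \<alpha>))"
proof (induction k)
  case 0 then show ?case using z \<tau> by simp
next
  case (Suc k)
  let ?b = "min \<tau> (real (Suc k) * mesh \<alpha>)"
  have "0 < mesh \<alpha>" using mesh_pos[OF \<alpha>] .
  then have "0 \<le> real (Suc k) * mesh \<alpha>" by (intro mult_nonneg_nonneg) auto
  then have "?b \<in> {0..1}" using \<tau> by (auto simp: min_def)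
  then have "\<alpha> ?b \<in> topspace Q"
    using continuous_map_image_subset_topspace[OF \<alpha>[unfolded pathin_def]] by auto
  moreover have "0 < F (q (lift_step z \<alpha> \<tau> k)) (\<alpha> ?b)"
    using Suc lift_step_admissible[OF \<alpha> \<tau>, of k] by simp
  ultimately show ?case using Suc T_in q_T by (simp del: of_nat_Suc)
qed

text \<open>Steps taken after the final time do not move, by the assumption \<open>T z (q z) = z\<close>.\<close>

lemma lift_step_eventually:
  assumes \<alpha>: "pathin Q \<alpha>" and \<tau>: "\<tau> \<in> {0..1}" and z: "z \<in> topspace X" "q z = \<alpha> 0"
    and k: "1 \<le> real k * mesh \<alpha>"
  shows "lift z \<alpha> \<tau> = lift_step z \<alpha> \<tau> k"
proof -
  let ?N = "nat \<lceil>1 / mesh \<alpha>\<rceil>"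
  have m: "0 < mesh \<alpha>" using mesh_pos[OF \<alpha>] .
  have "1 / mesh \<alpha> \<le> real k" using k m by (simp add: field_simps)
  then have "?N \<le> k" by linarith
  then show ?thesis
  proof (induction k rule: dec_induct)
    case base then show ?case by (simp add: lift_def)
  next
    case (step k)
    have "1 / mesh \<alpha> \<le> real k" using step(1) by linarith
    then have k: "1 \<le> real k * mesh \<alpha>" using m by (simp add: field_simps)
    then have "1 \<le> real (Suc k) * mesh \<alpha>" using m by (simp add: algebra_simps)
    then have *: "min \<tau> (real k * mesh \<alpha>) = \<tau>" "min \<tau> (real (Suc k) * mesh \<alpha>) = \<tau>"
      using k \<tau> by (auto simp: min_def simp del: of_nat_Suc)
    have "lift_step z \<alpha> \<tau> (Suc k) = T (lift_step z \<alpha> \<tau> k) (q (lift_step z \<alpha> \<tau> k))"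
      using lift_step_over[OF \<alpha> \<tau> z, of k] * by (simp del: of_nat_Suc)
    also have "\<dots> = lift_step z \<alpha> \<tau> k"
      using lift_step_over[OF \<alpha> \<tau> z, of k] by (intro T_id) simp
    finally show ?case using step by simp
  qed
qed

lemma
  assumes \<alpha>: "pathin Q \<alpha>" and z: "z \<in> topspace X" "q z = \<alpha> 0"
  shows lift_in: "\<And>\<tau>. \<tau> \<in> {0..1} \<Longrightarrow> lift z \<alpha> \<tau> \<in> topspace X"
    and q_lift: "\<And>\<tau>. \<tau> \<in> {0..1} \<Longrightarrow> q (lift z \<alpha> \<tau>) = \<alpha> \<tau>"
    and lift_0: "lift z \<alpha> 0 = z"
proof -
  let ?N = "nat \<lceil>1 / mesh \<alpha>\<rceil>"
  have m: "0 < mesh \<alpha>" using mesh_pos[OF \<alpha>] .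
  have "1 / mesh \<alpha> \<le> real ?N" by linarith
  then have N: "1 \<le> real ?N * mesh \<alpha>" using m by (simp only: pos_divide_le_eq)
  fix \<tau> :: real assume \<tau>: "\<tau> \<in> {0..1}"
  from lift_step_over[OF \<alpha> \<tau> z, of ?N] N \<tau>
  show "lift z \<alpha> \<tau> \<in> topspace X" "q (lift z \<alpha> \<tau>) = \<alpha> \<tau>"
    by (auto simp: lift_def min_def)
next
  have m: "0 < mesh \<alpha>" using mesh_pos[OF \<alpha>] .
  have "lift_step z \<alpha> 0 k = z" for k
  proof (induction k)
    case (Suc k)
    have "min 0 (real (Suc k) * mesh \<alpha>) = 0" using m by (simp add: min_def)
    then show ?case using Suc z T_id by (simp del: of_nat_Suc flip: z(2))
  qed simp
  then show "lift z \<alpha> 0 = z" by (simp add: lift_def)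
qed

text \<open>The step width depends on \<open>\<alpha>\<close> only, so a symmetry of the transport commutes with every step.\<close>

lemma lift_equivariant:
  assumes \<alpha>: "pathin Q \<alpha>" and \<tau>: "\<tau> \<in> {0..1}" and z: "z \<in> topspace X" "q z = \<alpha> 0"
    and gT: "\<And>z c. \<lbrakk>z \<in> topspace X; c \<in> topspace Q; 0 < F (q z) c\<rbrakk> \<Longrightarrow> T (g z) c = g (T z c)"
  shows "lift (g z) \<alpha> \<tau> = g (lift z \<alpha> \<tau>)"
proof -
  have "lift_step (g z) \<alpha> \<tau> k = g (lift_step z \<alpha> \<tau> k)" for k
  proof (induction k)
    case (Suc k)
    let ?b = "min \<tau> (real (Suc k) * mesh \<alpha>)"
    have "0 \<le> real (Suc k) * mesh \<alpha>" using mesh_pos[OF \<alpha>] by (intro mult_nonneg_nonneg) auto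
    then have "?b \<in> {0..1}" using \<tau> by (auto simp: min_def)
    then have "\<alpha> ?b \<in> topspace Q"
      using continuous_map_image_subset_topspace[OF \<alpha>[unfolded pathin_def]] by auto
    then show ?case
      using Suc lift_step_over[OF \<alpha> \<tau> z, of k] lift_step_admissible[OF \<alpha> \<tau>, of k]
      by (simp add: gT del: of_nat_Suc)
  qed simp
  then show ?thesis by (simp add: lift_def)
qed

text \<open>For a fixed number of steps the lift is a composition of continuous maps. A number of steps which suffices for one
parameter suffices nearby, as the step width is continuous, and more steps do not change the result; so the
local formulas can be pasted.\<close>

lemma continuous_map_lift:
  assumes H: "continuous_map (prod_topology Z (top_of_set {0..1})) Q (\<lambda>p. H (fst p) (snd p))"
    and z: "continuous_map Z X z" and z0: "\<And>\<zeta>. \<zeta> \<in> topspace Z \<Longrightarrow> q (z \<zeta>) = H \<zeta> 0"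
  shows "continuous_map (prod_topology Z (top_of_set {0..1})) X (\<lambda>p. lift (z (fst p)) (H (fst p)) (snd p))"
proof -
  let ?P = "prod_topology Z (top_of_set {0..1::real})"
  have path: "pathin Q (H \<zeta>)" if "\<zeta> \<in> topspace Z" for \<zeta>
  proof -
    have "continuous_map (top_of_set {0..1}) ?P (\<lambda>\<tau>. (\<zeta>, \<tau>))"
      using that by (intro continuous_map_pairedI) auto
    from continuous_map_compose[OF this H] show ?thesis by (simp add: o_def pathin_def)
  qed
  have zin: "z \<zeta> \<in> topspace X" if "\<zeta> \<in> topspace Z" for \<zeta>
    using continuous_map_image_subset_topspace[OF z] that by auto
  have m: "continuous_map Z euclideanreal (\<lambda>\<zeta>. mesh (H \<zeta>))"
    by (rule continuous_map_mesh[OF H])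
  have mP: "continuous_map ?P euclideanreal (\<lambda>p. mesh (H (fst p)))"
    using continuous_map_compose[OF continuous_map_fst m] by (simp add: o_def)
  have sP: "continuous_map ?P euclideanreal snd"
    using continuous_map_snd[of Z "top_of_set {0..1::real}"] by (simp add: continuous_map_in_subtopology)
  have step: "continuous_map ?P X (\<lambda>p. lift_step (z (fst p)) (H (fst p)) (snd p) k)" for k
  proof (induction k)
    case 0 then show ?case
      using continuous_map_compose[OF continuous_map_fst z] by (simp add: o_def)
  next
    case (Suc k)
    let ?b = "\<lambda>p. min (snd p) (real (Suc k) * mesh (H (fst p)))"
    have b: "?b p \<in> {0..1}" if "p \<in> topspace ?P" for p
    proof -
      have "0 \<le> real (Suc k) * mesh (H (fst p))"
        using mesh_pos[OF path, of "fst p"] that by (intro mult_nonneg_nonneg) auto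
      then show ?thesis using that by (auto simp: min_def)
    qed
    have "continuous_map ?P euclideanreal ?b"
      by (intro continuous_intros sP mP)
    then have "continuous_map ?P (top_of_set {0..1}) ?b"
      using b by (auto simp: continuous_map_in_subtopology simp del: of_nat_Suc)
    from continuous_map_compose[OF continuous_map_pairedI[OF continuous_map_fst this] H]
    have Hb: "continuous_map ?P Q (\<lambda>p. H (fst p) (?b p))" by (simp add: o_def)
    have "continuous_map ?P (subtopology (prod_topology X Q) {p. 0 < F (q (fst p)) (snd p)})
        (\<lambda>p. (lift_step (z (fst p)) (H (fst p)) (snd p) k, H (fst p) (?b p)))"
      unfolding continuous_map_in_subtopology
    proof (intro conjI continuous_map_pairedI Suc Hb funcsetI CollectI)
      fix p assume "p \<in> topspace ?P"
      then have p: "fst p \<in> topspace Z" "snd p \<in> {0..1}" by auto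
      have "q (lift_step (z (fst p)) (H (fst p)) (snd p) k) =
          H (fst p) (min (snd p) (real k * mesh (H (fst p))))"
        using lift_step_over[OF path[OF p(1)] p(2) zin[OF p(1)] z0[OF p(1)]] by blast
      then show "0 < F (q (fst (lift_step (z (fst p)) (H (fst p)) (snd p) k, H (fst p) (?b p))))
                 (snd (lift_step (z (fst p)) (H (fst p)) (snd p) k, H (fst p) (?b p)))"
        using lift_step_admissible[OF path[OF p(1)] p(2), of k] by (simp del: of_nat_Suc)
    qed
    from continuous_map_compose[OF this T_cont] show ?case by (simp add: o_def)
  qed
  have ev: "lift (z (fst p)) (H (fst p)) (snd p) = lift_step (z (fst p)) (H (fst p)) (snd p) k"
    if "p \<in> topspace ?P" "1 < real k * mesh (H (fst p))" for k p
    using that by (intro lift_step_eventually path zin z0) auto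
  define V where "V k = {p \<in> topspace ?P. real k * mesh (H (fst p)) \<in> {1<..}}" for k :: nat
  show ?thesis
  proof (rule pasting_lemma[where I = UNIV and T = V
        and f = "\<lambda>k p. lift_step (z (fst p)) (H (fst p)) (snd p) k"])
    show "openin ?P (V k)" for k
      unfolding V_def
      by (rule openin_continuous_map_preimage[where Y = euclideanreal])
        (intro continuous_intros mP, simp add: open_openin[symmetric])
    show "continuous_map (subtopology ?P (V k)) X (\<lambda>p. lift_step (z (fst p)) (H (fst p)) (snd p) k)" for k
      by (rule continuous_map_from_subtopology[OF step])
    show "lift_step (z (fst p)) (H (fst p)) (snd p) i = lift_step (z (fst p)) (H (fst p)) (snd p) j"
      if "i \<in> UNIV" "j \<in> UNIV" "p \<in> topspace ?P \<inter> V i \<inter> V j" for i j p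
      using that ev[of p i] ev[of p j] by (simp add: V_def)
    show "\<exists>k. k \<in> UNIV \<and> p \<in> V k \<and>
            lift (z (fst p)) (H (fst p)) (snd p) = lift_step (z (fst p)) (H (fst p)) (snd p) k"
      if p: "p \<in> topspace ?P" for p
    proof -
      have "0 < mesh (H (fst p))" using p by (intro mesh_pos path) auto
      then obtain k where "1 < real k * mesh (H (fst p))" using reals_Archimedean3 by blast
      then show ?thesis using p ev[of p k] by (auto simp: V_def)
    qed
  qed
qed

end


section \<open>Approximate comparison by roots of unity\<close>

definition herm :: "nat \<Rightarrow> (nat \<Rightarrow> complex) \<Rightarrow> (nat \<Rightarrow> complex) \<Rightarrow> complex" where
  "herm m x y = (\<Sum>j\<le>m. x j * cnj (y j))"

text \<open>Away from 0, a retraction onto \<open>root_group t\<close> which commutes with multiplication by elements of the group: for \<open>t = \<infinity>\<close>, radial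
projection onto the circle; for finite \<open>t = k\<close>, the \<open>k\<close>-th root of unity in whose sector of angle
\<open>2 \<pi> / k\<close> the number \<open>u\<close> lies.\<close>

definition phase :: "enat \<Rightarrow> complex \<Rightarrow> complex" where
  "phase t u = (case t of enat k \<Rightarrow> u / exp (Ln (u ^ k) / of_nat k) | \<infinity> \<Rightarrow> u / of_real (cmod u))"

text \<open>Its positivity keeps \<open>u\<close> away from the points where \<open>phase\<close> may jump: it vanishes at 0 and, for finite \<open>t = k\<close>,
on the boundaries between the sectors, where \<open>u ^ k\<close> is a negative real number.\<close>

definition phase_gap :: "enat \<Rightarrow> complex \<Rightarrow> real" where
  "phase_gap t u = (case t of enat k \<Rightarrow> cmod (u ^ k) + Re (u ^ k) | \<infinity> \<Rightarrow> cmod u)"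

lemma root_groupD: "w \<in> root_group t \<Longrightarrow> cmod w = 1"
  by (auto simp: root_group_def split: enat.splits)

lemma cnj_root_group: "w \<in> root_group t \<Longrightarrow> cnj w \<in> root_group t"
  by (auto simp: root_group_def simp flip: complex_cnj_power split: enat.splits)

lemma cnj_mult_root_group: "w \<in> root_group t \<Longrightarrow> cnj w * w = 1"
  using root_groupD[of w t] complex_norm_square[of w] by (simp add: mult.commute)

lemma phase_gap_mult: "w \<in> root_group t \<Longrightarrow> phase_gap t (w * u) = phase_gap t u"
  by (auto simp: phase_gap_def root_group_def norm_mult power_mult_distrib split: enat.splits)

lemma phase_mult: "w \<in> root_group t \<Longrightarrow> phase t (w * u) = w * phase t u"
  by (auto simp: phase_def root_group_def norm_mult power_mult_distrib split: enat.splits)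

lemma phase_gap_nonneg: "0 \<le> phase_gap t u"
  using abs_Re_le_cmod[of "u ^ the_enat t"] by (auto simp: phase_gap_def split: enat.splits)

lemma phase_gap_1: "0 < phase_gap t 1"
  by (auto simp: phase_gap_def split: enat.splits)

lemma phase_1: "phase t 1 = 1"
  by (auto simp: phase_def split: enat.splits)

lemma continuous_on_phase_gap: "continuous_on S (phase_gap t)"
  by (cases t) (auto simp: phase_gap_def[abs_def] intro!: continuous_intros)

lemma phase_gap_pos_imp: "0 < phase_gap (enat k) u \<Longrightarrow> u ^ k \<notin> \<real>\<^sub>\<le>\<^sub>0"
  by (auto simp: phase_gap_def complex_nonpos_Reals_iff cmod_eq_Re)

lemma phase_in_root_group:
  assumes t: "0 < t" and u: "0 < phase_gap t u"
  shows "phase t u \<in> root_group t"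
proof (cases t)
  case (enat k)
  then have k: "k \<noteq> 0" using t by (auto simp: zero_enat_def)
  have u0: "u ^ k \<noteq> 0" using phase_gap_pos_imp[of k u] u enat by (metis nonpos_Reals_zero_I)
  have "phase t u ^ k = u ^ k / exp (Ln (u ^ k))"
    using k by (simp add: phase_def enat power_divide flip: exp_of_nat_mult)
  also have "\<dots> = 1" using u0 by simp
  finally have "phase t u ^ k = 1" .
  then show ?thesis using k power_eq_1_iff[of "phase t u" k]
    by (auto simp: root_group_def enat)
next
  case infinity
  then show ?thesis using u by (auto simp: phase_def phase_gap_def root_group_def norm_divide)
qed

lemma continuous_on_phase:
  assumes "0 < t"
  shows "continuous_on {u. 0 < phase_gap t u} (phase t)"
proof (cases t)
  case (enat k)
  then have "k \<noteq> 0" using assms by (auto simp: zero_enat_def)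
  then show ?thesis unfolding enat phase_def[abs_def]
    using phase_gap_pos_imp[of k] by (auto intro!: continuous_intros)
next
  case infinity
  then show ?thesis
    unfolding phase_def[abs_def] by (auto simp: phase_gap_def intro!: continuous_intros)
qed

section \<open>Orbits of the diagonal action\<close>

definition rotate_by :: "nat list \<Rightarrow> complex \<Rightarrow> (nat \<Rightarrow> nat \<Rightarrow> complex) \<Rightarrow> nat \<Rightarrow> nat \<Rightarrow> complex" where
  "rotate_by ns w x = (\<lambda>i\<in>{..<length ns}. \<lambda>j. w * x i j)"

lemma herm_scale_left: "herm m (\<lambda>j. w * x j) y = w * herm m x y"
  by (simp add: herm_def sum_distrib_left mult.assoc)

lemma herm_scale_right: "herm m x (\<lambda>j. w * y j) = cnj w * herm m x y"
  by (simp add: herm_def sum_distrib_left mult_ac)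

lemma herm_self: "herm m x x = of_real (\<Sum>j\<le>m. (cmod (x j))\<^sup>2)"
  by (simp only: herm_def complex_norm_square of_real_sum)

lemma in_sphere_product:
  "x \<in> topspace (sphere_product ns) \<longleftrightarrow> x \<in> extensional {..<length ns} \<and>
     (\<forall>i<length ns. (\<Sum>j\<le>ns ! i. (cmod (x i j))\<^sup>2) = 1 \<and> (\<forall>j>ns ! i. x i j = 0))"
  by (auto simp: sphere_product_def complex_sphere_def PiE_iff)

text \<open>The topology of the product of spheres is the one of coordinatewise convergence.\<close>

lemma continuous_map_into_sphere_product:
  "continuous_map Z (sphere_product ns) f \<longleftrightarrow>
     (\<forall>z\<in>topspace Z. f z \<in> topspace (sphere_product ns)) \<and>
     (\<forall>i<length ns. \<forall>j. continuous_map Z euclidean (\<lambda>z. f z i j))"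
proof -
  have "continuous_map Z (sphere_product ns) f \<longleftrightarrow> f ` topspace Z \<subseteq> extensional {..<length ns} \<and>
     (\<forall>i<length ns. (\<forall>j. continuous_map Z euclidean (\<lambda>z. f z i j)) \<and>
       (\<forall>z\<in>topspace Z. (\<Sum>j\<le>ns ! i. (cmod (f z i j))\<^sup>2) = 1 \<and> (\<forall>j>ns ! i. f z i j = 0)))"
    unfolding sphere_product_def complex_sphere_def continuous_map_componentwise
      continuous_map_in_subtopology continuous_map_componentwise_UNIV
    by (simp add: Pi_iff Ball_def)
  then show ?thesis
    unfolding in_sphere_product by blast
qed

lemma continuous_map_coordinate:
  "i < length ns \<Longrightarrow> continuous_map (sphere_product ns) euclidean (\<lambda>x. x i j)"
  using continuous_map_into_sphere_product[of "sphere_product ns" ns id] by simp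

lemma continuous_map_herm:
  assumes "\<And>j. continuous_map Z euclidean (\<lambda>z. f z j)" and "\<And>j. continuous_map Z euclidean (\<lambda>z. g z j)"
  shows "continuous_map Z euclidean (\<lambda>z. herm m (f z) (g z))"
  unfolding herm_def
proof (intro continuous_map_sum continuous_map_complex_mult assms)
  show "continuous_map Z euclidean (\<lambda>z. cnj (g z j))" for j
    by (rule continuous_map_unary_op[OF assms(2), of UNIV]) (auto intro!: continuous_intros)
qed auto

lemma rotate_by_in:
  assumes "cmod w = 1" and "x \<in> topspace (sphere_product ns)"
  shows "rotate_by ns w x \<in> topspace (sphere_product ns)"
  using assms by (auto simp: in_sphere_product rotate_by_def norm_mult)

lemma rotate_by_rotate_by: "rotate_by ns v (rotate_by ns w x) = rotate_by ns (v * w) x"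
  by (auto simp: rotate_by_def fun_eq_iff restrict_def)

lemma rotate_by_1: "x \<in> topspace (sphere_product ns) \<Longrightarrow> rotate_by ns 1 x = x"
  by (auto simp: rotate_by_def in_sphere_product extensional_restrict)

lemma continuous_map_rotate_by:
  assumes "cmod w = 1"
  shows "continuous_map (sphere_product ns) (sphere_product ns) (rotate_by ns w)"
  unfolding continuous_map_into_sphere_product
  using assms by (auto simp: rotate_by_in) 
    (auto simp: rotate_by_def intro!: continuous_map_complex_mult continuous_map_coordinate)

definition orb :: "nat list \<Rightarrow> enat \<Rightarrow> (nat \<Rightarrow> nat \<Rightarrow> complex) \<Rightarrow> (nat \<Rightarrow> nat \<Rightarrow> complex) set" where
  "orb ns t x = diagonal_orbit_rel ns t `` {x}"

lemma diagonal_orbit_rel_iff: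
  assumes "x \<in> topspace (sphere_product ns)" and "y \<in> topspace (sphere_product ns)"
  shows "(x, y) \<in> diagonal_orbit_rel ns t \<longleftrightarrow> (\<exists>w\<in>root_group t. y = rotate_by ns w x)"
proof -
  have "y = rotate_by ns w x \<longleftrightarrow> (\<forall>i<length ns. \<forall>j. y i j = w * x i j)" for w
    using assms(2) by (auto simp: in_sphere_product rotate_by_def fun_eq_iff extensional_def)
  then show ?thesis using assms by (simp add: diagonal_orbit_rel_def)
qed

lemma orb_eq_iff:
  assumes "x \<in> topspace (sphere_product ns)" and "y \<in> topspace (sphere_product ns)"
  shows "orb ns t x = orb ns t y \<longleftrightarrow> (\<exists>w\<in>root_group t. y = rotate_by ns w x)"
  unfolding orb_def
  using eq_equiv_class_iff[OF equiv_diagonal_orbit_rel assms] diagonal_orbit_rel_iff[OF assms] by simp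

lemma orb_rotate_by:
  assumes "x \<in> topspace (sphere_product ns)" and "w \<in> root_group t"
  shows "orb ns t (rotate_by ns w x) = orb ns t x"
  using orb_eq_iff[OF assms(1) rotate_by_in[OF root_groupD[OF assms(2)] assms(1)], of t] assms(2) by blast

lemma topspace_CP_space: "topspace (CP_space ns t) = orb ns t ` topspace (sphere_product ns)"
  by (auto simp: CP_space_def topspace_quotient_topology orb_def quotient_def)

lemma quotient_map_orb: "quotient_map (sphere_product ns) (CP_space ns t) (orb ns t)"
  unfolding CP_space_def orb_def by (rule quotient_map_quotient_topology)

lemma continuous_map_orb: "continuous_map (sphere_product ns) (CP_space ns t) (orb ns t)"
  by (rule quotient_imp_continuous_map[OF quotient_map_orb])

text \<open>The saturation of an open set is the union of its rotated copies.\<close>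

lemma open_map_orb: "open_map (sphere_product ns) (CP_space ns t) (orb ns t)"
  unfolding open_map_def
proof (intro allI impI)
  fix V assume V: "openin (sphere_product ns) V"
  have "{x \<in> topspace (sphere_product ns). orb ns t x \<in> orb ns t ` V} =
      (\<Union>w\<in>root_group t. {x \<in> topspace (sphere_product ns). rotate_by ns w x \<in> V})"
  proof (intro equalityI subsetI)
    fix x assume "x \<in> {x \<in> topspace (sphere_product ns). orb ns t x \<in> orb ns t ` V}"
    then obtain v where v: "x \<in> topspace (sphere_product ns)" "v \<in> V" "orb ns t x = orb ns t v" by auto
    then have "v \<in> topspace (sphere_product ns)" using openin_subset[OF V] by auto
    with v show "x \<in> (\<Union>w\<in>root_group t. {x \<in> topspace (sphere_product ns). rotate_by ns w x \<in> V})"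
      using orb_eq_iff[of x ns v t] by auto
  next
    fix x assume "x \<in> (\<Union>w\<in>root_group t. {x \<in> topspace (sphere_product ns). rotate_by ns w x \<in> V})"
    then obtain w where "w \<in> root_group t" "x \<in> topspace (sphere_product ns)" "rotate_by ns w x \<in> V" by auto
    then show "x \<in> {x \<in> topspace (sphere_product ns). orb ns t x \<in> orb ns t ` V}"
      using orb_rotate_by[of x ns w t] by (auto intro!: image_eqI[of _ _ "rotate_by ns w x"])
  qed
  moreover have "openin (sphere_product ns) {x \<in> topspace (sphere_product ns). rotate_by ns w x \<in> V}"
    if "w \<in> root_group t" for w
    by (rule openin_continuous_map_preimage[OF continuous_map_rotate_by V]) (rule root_groupD[OF that])
  ultimately have "openin (sphere_product ns) {x \<in> topspace (sphere_product ns). orb ns t x \<in> orb ns t ` V}"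
    by (auto intro!: openin_Union)
  moreover have "orb ns t ` V \<subseteq> topspace (CP_space ns t)"
    using openin_subset[OF V] by (auto simp: topspace_CP_space)
  ultimately show "openin (CP_space ns t) (orb ns t ` V)"
    using quotient_map_orb[of ns t] by (simp add: quotient_map_def)
qed

lemma quotient_map_orb_prod:
  "quotient_map (prod_topology (sphere_product ns) (sphere_product ns))
     (prod_topology (CP_space ns t) (CP_space ns t)) (\<lambda>p. (orb ns t (fst p), orb ns t (snd p)))"
  by (rule quotient_map_prod_open[OF quotient_map_orb open_map_orb quotient_map_orb open_map_orb])

lemma quotient_map_id_orb:
  "quotient_map (prod_topology Z (sphere_product ns)) (prod_topology Z (CP_space ns t))
     (\<lambda>p. (fst p, orb ns t (snd p)))"
proof (rule quotient_map_prod_open[OF _ _ quotient_map_orb open_map_orb])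
  show "quotient_map Z Z (\<lambda>x. x)" "open_map Z Z (\<lambda>x. x)"
    using continuous_open_imp_quotient_map[of Z Z "\<lambda>x. x"] open_map_id[of Z] by (simp_all add: id_def)
qed

section \<open>Nearest lifts of orbits\<close>

definition rep :: "nat list \<Rightarrow> enat \<Rightarrow> (nat \<Rightarrow> nat \<Rightarrow> complex) set \<Rightarrow> nat \<Rightarrow> nat \<Rightarrow> complex" where
  "rep ns t c = (SOME x. x \<in> topspace (sphere_product ns) \<and> orb ns t x = c)"

text \<open>Only the first sphere is used to compare two orbits. By \<open>phase_gap_mult\<close> the value does not depend on the representatives,
although its definition has to choose some.\<close>

definition orbit_gap :: "nat list \<Rightarrow> enat \<Rightarrow> (nat \<Rightarrow> nat \<Rightarrow> complex) set \<Rightarrow> (nat \<Rightarrow> nat \<Rightarrow> complex) set \<Rightarrow> real" where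
  "orbit_gap ns t c d = phase_gap t (herm (ns ! 0) (rep ns t c 0) (rep ns t d 0))"

text \<open>The representative \<open>w y\<close> of the orbit of \<open>y\<close> for which the inner product of the first components of \<open>x\<close> and \<open>w y\<close> has
its argument closest to 0. For \<open>t = \<infinity>\<close> and a single sphere this is parallel transport along the shortest path between
the two points of the projective space.\<close>

definition nearest_lift :: "nat list \<Rightarrow> enat \<Rightarrow> (nat \<Rightarrow> nat \<Rightarrow> complex) \<Rightarrow> (nat \<Rightarrow> nat \<Rightarrow> complex) set \<Rightarrow> nat \<Rightarrow> nat \<Rightarrow> complex" where
  "nearest_lift ns t x c =
     (let y = rep ns t c in rotate_by ns (phase t (herm (ns ! 0) (x 0) (y 0))) y)"

lemma rep_orb:
  assumes "x \<in> topspace (sphere_product ns)"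
  obtains w where "w \<in> root_group t" and "rep ns t (orb ns t x) = rotate_by ns w x"
proof -
  have "rep ns t (orb ns t x) \<in> topspace (sphere_product ns) \<and> orb ns t (rep ns t (orb ns t x)) = orb ns t x"
    unfolding rep_def by (rule someI[of _ x]) (simp add: assms)
  then show ?thesis using that orb_eq_iff[OF assms, of "rep ns t (orb ns t x)" t] by metis
qed

lemma orbit_gap_orb:
  assumes ns: "ns \<noteq> []" and x: "x \<in> topspace (sphere_product ns)" and y: "y \<in> topspace (sphere_product ns)"
  shows "orbit_gap ns t (orb ns t x) (orb ns t y) = phase_gap t (herm (ns ! 0) (x 0) (y 0))"
proof -
  obtain v where v: "v \<in> root_group t" "rep ns t (orb ns t x) = rotate_by ns v x" using rep_orb[OF x] .
  obtain w where w: "w \<in> root_group t" "rep ns t (orb ns t y) = rotate_by ns w y" using rep_orb[OF y] .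
  show ?thesis
    using ns v w
    by (simp add: orbit_gap_def rotate_by_def herm_scale_left herm_scale_right phase_gap_mult cnj_root_group)
qed

lemma nearest_lift_orb:
  assumes ns: "ns \<noteq> []" and y: "y \<in> topspace (sphere_product ns)"
  shows "nearest_lift ns t x (orb ns t y) = rotate_by ns (phase t (herm (ns ! 0) (x 0) (y 0))) y"
proof -
  obtain w where w: "w \<in> root_group t" "rep ns t (orb ns t y) = rotate_by ns w y" using rep_orb[OF y] .
  have "herm (ns ! 0) (x 0) (rotate_by ns w y 0) = cnj w * herm (ns ! 0) (x 0) (y 0)"
    using ns by (simp add: rotate_by_def herm_scale_right)
  moreover have "cnj w * a * w = a" for a
    using cnj_mult_root_group[OF w(1)] by (simp add: mult.commute mult.left_commute)
  ultimately show ?thesis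
    by (simp only: nearest_lift_def Let_def w(2) phase_mult[OF cnj_root_group[OF w(1)]] rotate_by_rotate_by)
qed

lemma herm_self_sphere:
  "\<lbrakk>x \<in> topspace (sphere_product ns); i < length ns\<rbrakk> \<Longrightarrow> herm (ns ! i) (x i) (x i) = 1"
  by (simp add: herm_self in_sphere_product)

text \<open>Continuity on the quotient is tested on representatives, where the formulas for gap and lift are explicit; this is
legitimate because \<open>orb\<close> is an open quotient map and hence so are its products with itself and with the identity.\<close>

lemma transport_orb:
  assumes t: "0 < t" and ns: "ns \<noteq> []"
  shows "transport (sphere_product ns) (CP_space ns t) (orb ns t) (orbit_gap ns t) (nearest_lift ns t)"
proof
  let ?P = "sphere_product ns" and ?Q = "CP_space ns t"
  let ?h = "\<lambda>p. herm (ns ! 0) (fst p 0) (snd p 0)"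
  have coord: "continuous_map (prod_topology ?P ?P) euclidean (\<lambda>p. fst p i j)"
    "continuous_map (prod_topology ?P ?P) euclidean (\<lambda>p. snd p i j)" if "i < length ns" for i j
    using continuous_map_compose[OF continuous_map_fst continuous_map_coordinate[OF that]]
      continuous_map_compose[OF continuous_map_snd continuous_map_coordinate[OF that]]
    by (simp_all add: o_def)
  have h: "continuous_map (prod_topology ?P ?P) euclidean ?h"
    using ns by (intro continuous_map_herm coord) auto
  show "continuous_map ?P ?Q (orb ns t)" by (rule continuous_map_orb)
  show F: "continuous_map (prod_topology ?Q ?Q) euclideanreal (\<lambda>p. orbit_gap ns t (fst p) (snd p))"
  proof (rule continuous_compose_quotient_map[OF quotient_map_orb_prod])
    have "continuous_map (prod_topology ?P ?P) euclideanreal (\<lambda>p. phase_gap t (?h p))"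
      by (rule continuous_map_unary_op[OF h continuous_on_phase_gap[of UNIV]]) auto
    then show "continuous_map (prod_topology ?P ?P) euclideanreal
       ((\<lambda>p. orbit_gap ns t (fst p) (snd p)) \<circ> (\<lambda>p. (orb ns t (fst p), orb ns t (snd p))))"
      by (rule continuous_map_eq) (use ns in \<open>auto simp: orbit_gap_orb\<close>)
  qed
  show "0 \<le> orbit_gap ns t c d" for c d
    by (simp add: orbit_gap_def phase_gap_nonneg)
  show "0 < orbit_gap ns t c c" if "c \<in> topspace ?Q" for c
    using that ns by (auto simp: topspace_CP_space orbit_gap_orb herm_self_sphere phase_gap_1)
  show "nearest_lift ns t x (orb ns t x) = x" if "x \<in> topspace ?P" for x
    using that ns by (simp add: nearest_lift_orb herm_self_sphere phase_1 rotate_by_1)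
  show "orb ns t (nearest_lift ns t x c) = c"
    if "x \<in> topspace ?P" "c \<in> topspace ?Q" "0 < orbit_gap ns t (orb ns t x) c" for x c
    using that ns t
    by (auto simp: topspace_CP_space orbit_gap_orb nearest_lift_orb orb_rotate_by phase_in_root_group)
  show "continuous_map (subtopology (prod_topology ?P ?Q) {p. 0 < orbit_gap ns t (orb ns t (fst p)) (snd p)}) ?P
          (\<lambda>p. nearest_lift ns t (fst p) (snd p))"
  proof -
    define V where "V = {p \<in> topspace (prod_topology ?P ?Q). orbit_gap ns t (orb ns t (fst p)) (snd p) \<in> {0<..}}"
    define U where "U = {p \<in> topspace (prod_topology ?P ?P). 0 < phase_gap t (?h p)}"
    have "continuous_map (prod_topology ?P ?Q) (prod_topology ?Q ?Q) (\<lambda>p. (orb ns t (fst p), snd p))"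
      using continuous_map_compose[OF continuous_map_fst continuous_map_orb]
      by (intro continuous_map_pairedI continuous_map_snd) (simp add: o_def)
    from continuous_map_compose[OF this F]
    have "continuous_map (prod_topology ?P ?Q) euclideanreal (\<lambda>p. orbit_gap ns t (orb ns t (fst p)) (snd p))"
      by (simp add: o_def)
    then have V: "openin (prod_topology ?P ?Q) V"
      unfolding V_def by (rule openin_continuous_map_preimage) (simp add: open_openin[symmetric])
    have "{p \<in> topspace (prod_topology ?P ?P). (fst p, orb ns t (snd p)) \<in> V} = U"
      using ns by (auto simp: V_def U_def orbit_gap_orb topspace_CP_space)
    from quotient_map_restriction[OF quotient_map_id_orb this disjI1[OF V]]
    have quo: "quotient_map (subtopology (prod_topology ?P ?P) U) (subtopology (prod_topology ?P ?Q) V)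
      (\<lambda>p. (fst p, orb ns t (snd p)))" .
    have ph: "continuous_map (subtopology (prod_topology ?P ?P) U) euclidean (\<lambda>p. phase t (?h p))"
      by (rule continuous_map_unary_op[OF continuous_map_from_subtopology[OF h] continuous_on_phase[OF t]])
        (auto simp: U_def)
    have "continuous_map (subtopology (prod_topology ?P ?P) U) ?P (\<lambda>p. rotate_by ns (phase t (?h p)) (snd p))"
      unfolding continuous_map_into_sphere_product
    proof (intro conjI ballI allI impI)
      fix p assume "p \<in> topspace (subtopology (prod_topology ?P ?P) U)"
      then have "0 < phase_gap t (?h p)" "snd p \<in> topspace ?P" by (auto simp: U_def)
      then show "rotate_by ns (phase t (?h p)) (snd p) \<in> topspace ?P"
        by (intro rotate_by_in[OF root_groupD[OF phase_in_root_group[OF t]]])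
    next
      fix i j assume i: "i < length ns"
      have "continuous_map (subtopology (prod_topology ?P ?P) U) euclidean (\<lambda>p. phase t (?h p) * snd p i j)"
        by (intro continuous_map_complex_mult ph continuous_map_from_subtopology coord i)
      then show "continuous_map (subtopology (prod_topology ?P ?P) U) euclidean
          (\<lambda>p. rotate_by ns (phase t (?h p)) (snd p) i j)"
        using i by (simp add: rotate_by_def)
    qed
    then have "continuous_map (subtopology (prod_topology ?P ?P) U) ?P
        ((\<lambda>p. nearest_lift ns t (fst p) (snd p)) \<circ> (\<lambda>p. (fst p, orb ns t (snd p))))"
      by (rule continuous_map_eq) (use ns in \<open>auto simp: nearest_lift_orb\<close>)
    from continuous_compose_quotient_map[OF quo this]
    have "continuous_map (subtopology (prod_topology ?P ?Q) V) ?P (\<lambda>p. nearest_lift ns t (fst p) (snd p))" .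
    moreover have "subtopology (prod_topology ?P ?Q) V =
        subtopology (prod_topology ?P ?Q) {p. 0 < orbit_gap ns t (orb ns t (fst p)) (snd p)}"
    proof -
      have "V = topspace (prod_topology ?P ?Q) \<inter> {p. 0 < orbit_gap ns t (orb ns t (fst p)) (snd p)}"
        by (auto simp: V_def)
      then show ?thesis by (simp only: subtopology_restrict)
    qed
    ultimately show ?thesis by simp
  qed
qed

lemma nearest_lift_rotate_by:
  assumes "ns \<noteq> []" and "w \<in> root_group t" and c: "c \<in> topspace (CP_space ns t)"
  shows "nearest_lift ns t (rotate_by ns w x) c = rotate_by ns w (nearest_lift ns t x c)"
proof -
  obtain y where y: "y \<in> topspace (sphere_product ns)" "c = orb ns t y"
    using c by (auto simp: topspace_CP_space)
  have "herm (ns ! 0) (rotate_by ns w x 0) (y 0) = w * herm (ns ! 0) (x 0) (y 0)"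
    using assms(1) by (simp add: rotate_by_def herm_scale_left)
  then show ?thesis
    by (simp add: y(2) nearest_lift_orb[OF assms(1) y(1)] phase_mult[OF assms(2)] rotate_by_rotate_by)
qed


section \<open>Equivariant paths on odd spheres\<close>

text \<open>The factor \<open>cis (\<theta> * (1 - \<tau>))\<close> is 1 at the end of the path, and at its beginning the second summand vanishes; so the
path joins \<open>x\<close> to \<open>y\<close> for every \<open>\<theta>\<close>. The formula is complex linear in \<open>(x, y)\<close>, which makes the path equivariant.\<close>

definition blend :: "real \<Rightarrow> (nat \<Rightarrow> complex) \<Rightarrow> (nat \<Rightarrow> complex) \<Rightarrow> real \<Rightarrow> nat \<Rightarrow> complex" where
  "blend \<theta> x y \<tau> j = of_real (1 - \<tau>) * x j + of_real \<tau> * cis (\<theta> * (1 - \<tau>)) * y j"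

definition sphere_path ::
    "nat \<Rightarrow> real \<Rightarrow> (nat \<Rightarrow> complex) \<Rightarrow> (nat \<Rightarrow> complex) \<Rightarrow> real \<Rightarrow> nat \<Rightarrow> complex" where
  "sphere_path m \<theta> x y \<tau> j = blend \<theta> x y \<tau> j / of_real (sqrt (\<Sum>i\<le>m. (cmod (blend \<theta> x y \<tau> i))\<^sup>2))"

text \<open>If the combination of two unit vectors vanishes, then its coefficients have the same modulus; so \<open>\<tau> = 1 / 2\<close> and
\<open>x = - cis (\<theta> / 2) y\<close>.\<close>

lemma blend_nonzero:
  assumes x: "(\<Sum>j\<le>m. (cmod (x j))\<^sup>2) = 1" and y: "(\<Sum>j\<le>m. (cmod (y j))\<^sup>2) = 1"
    and \<tau>: "\<tau> \<in> {0..1}" and u: "herm m x y \<noteq> - cis (\<theta> / 2)"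
  shows "0 < (\<Sum>j\<le>m. (cmod (blend \<theta> x y \<tau> j))\<^sup>2)"
proof (rule ccontr)
  assume "\<not> ?thesis"
  then have "(\<Sum>j\<le>m. (cmod (blend \<theta> x y \<tau> j))\<^sup>2) = 0"
    using sum_nonneg[of "{..m}" "\<lambda>j. (cmod (blend \<theta> x y \<tau> j))\<^sup>2"] by simp
  then have "blend \<theta> x y \<tau> j = 0" if "j \<le> m" for j
    using that by (simp add: sum_nonneg_eq_0_iff)
  then have eq: "of_real (1 - \<tau>) * x j = - (of_real \<tau> * cis (\<theta> * (1 - \<tau>)) * y j)" if "j \<le> m" for j
    using that by (simp add: blend_def eq_neg_iff_add_eq_0)
  have "(1 - \<tau>)\<^sup>2 * (cmod (x j))\<^sup>2 = \<tau>\<^sup>2 * (cmod (y j))\<^sup>2" if "j \<le> m" for j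
    using arg_cong[OF eq[OF that], of "\<lambda>z. (cmod z)\<^sup>2"]
    unfolding norm_minus_cancel norm_mult norm_of_real norm_cis power_mult_distrib by simp
  then have "(\<Sum>j\<le>m. (1 - \<tau>)\<^sup>2 * (cmod (x j))\<^sup>2) = (\<Sum>j\<le>m. \<tau>\<^sup>2 * (cmod (y j))\<^sup>2)"
    by (intro sum.cong) auto
  then have "(1 - \<tau>)\<^sup>2 = \<tau>\<^sup>2" using x y by (simp flip: sum_distrib_left)
  then have \<tau>2: "\<tau> = 1 / 2" by (simp add: power2_eq_square algebra_simps)
  have half: "x j = - cis (\<theta> / 2) * y j" if "j \<le> m" for j
    using eq[OF that] by (simp add: \<tau>2)
  have "herm m x y = herm m (\<lambda>j. - cis (\<theta> / 2) * y j) y"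
    unfolding herm_def using half by (intro sum.cong) auto
  also have "\<dots> = - cis (\<theta> / 2)" using y by (simp only: herm_scale_left herm_self) simp
  finally show False using u by simp
qed

lemma sphere_path_unit:
  assumes "0 < (\<Sum>j\<le>m. (cmod (blend \<theta> x y \<tau> j))\<^sup>2)"
  shows "(\<Sum>j\<le>m. (cmod (sphere_path m \<theta> x y \<tau> j))\<^sup>2) = 1"
proof -
  have "(cmod (sphere_path m \<theta> x y \<tau> j))\<^sup>2 =
      (cmod (blend \<theta> x y \<tau> j))\<^sup>2 / (\<Sum>j\<le>m. (cmod (blend \<theta> x y \<tau> j))\<^sup>2)" for j
    using assms by (simp add: sphere_path_def norm_divide power_divide)
  then show ?thesis using assms by (simp flip: sum_divide_distrib)
qed

lemma sphere_path_0: "(\<Sum>j\<le>m. (cmod (x j))\<^sup>2) = 1 \<Longrightarrow> sphere_path m \<theta> x y 0 = x"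
  by (simp add: sphere_path_def blend_def fun_eq_iff)

lemma sphere_path_1: "(\<Sum>j\<le>m. (cmod (y j))\<^sup>2) = 1 \<Longrightarrow> sphere_path m \<theta> x y 1 = y"
  by (simp add: sphere_path_def blend_def fun_eq_iff)

lemma sphere_path_equivariant:
  assumes "cmod w = 1"
  shows "sphere_path m \<theta> (\<lambda>j. w * x j) (\<lambda>j. w * y j) \<tau> = (\<lambda>j. w * sphere_path m \<theta> x y \<tau> j)"
proof -
  have "blend \<theta> (\<lambda>j. w * x j) (\<lambda>j. w * y j) \<tau> j = w * blend \<theta> x y \<tau> j" for j
    by (simp add: blend_def algebra_simps)
  then show ?thesis using assms by (simp add: sphere_path_def fun_eq_iff norm_mult)
qed

lemma continuous_map_sphere_path:
  assumes \<theta>: "continuous_map Z euclideanreal \<theta>" and \<tau>: "continuous_map Z euclideanreal \<tau>"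
    and x: "\<And>j. continuous_map Z euclidean (\<lambda>z. x z j)" and y: "\<And>j. continuous_map Z euclidean (\<lambda>z. y z j)"
    and pos: "\<And>z. z \<in> topspace Z \<Longrightarrow> 0 < (\<Sum>j\<le>m. (cmod (blend (\<theta> z) (x z) (y z) (\<tau> z) j))\<^sup>2)"
  shows "continuous_map Z euclidean (\<lambda>z. sphere_path m (\<theta> z) (x z) (y z) (\<tau> z) j)"
proof -
  have ofr: "continuous_map Z euclidean (\<lambda>z. complex_of_real (f z))" if "continuous_map Z euclideanreal f" for f
    by (rule continuous_map_unary_op[OF that, of UNIV]) (auto intro!: continuous_intros)
  have c: "continuous_map Z euclidean (\<lambda>z. cis (f z))" if "continuous_map Z euclideanreal f" for f
    by (rule continuous_map_unary_op[OF that, of UNIV]) (auto intro!: continuous_intros)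
  have b: "continuous_map Z euclidean (\<lambda>z. blend (\<theta> z) (x z) (y z) (\<tau> z) j)" for j
    unfolding blend_def
    by (intro continuous_map_add continuous_map_complex_mult x y ofr c continuous_map_real_mult
        continuous_map_diff \<theta> \<tau>) auto
  have s: "continuous_map Z euclideanreal (\<lambda>z. \<Sum>j\<le>m. (cmod (blend (\<theta> z) (x z) (y z) (\<tau> z) j))\<^sup>2)"
    by (intro continuous_map_sum continuous_map_real_pow continuous_map_norm b) auto
  have i: "continuous_map Z euclidean
      (\<lambda>z. inverse (complex_of_real (sqrt (\<Sum>j\<le>m. (cmod (blend (\<theta> z) (x z) (y z) (\<tau> z) j))\<^sup>2))))"
    by (rule continuous_map_unary_op[OF s, of "{0<..}" "\<lambda>v. inverse (complex_of_real (sqrt v))"])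
      (use pos in \<open>auto intro!: continuous_intros\<close>)
  show ?thesis
    using continuous_map_complex_mult[OF b i] by (simp add: sphere_path_def divide_inverse)
qed

section \<open>Separating finitely many functions by a cut value\<close>

text \<open>The points at which some level \<open>c\<close> has exactly \<open>k\<close> of the values above it and the remaining ones below it. Levels
are confined to \<open>[-1, 1]\<close> so that values above one exceed \<open>- 1\<close>, and values below one are less than 1; these are the
conditions under which the rules \<open>\<theta> = 0\<close> and \<open>\<theta> = pi\<close> work.\<close>

definition cut_set :: "'z topology \<Rightarrow> 'i set \<Rightarrow> ('i \<Rightarrow> 'z \<Rightarrow> real) \<Rightarrow> nat \<Rightarrow> 'z set" where
  "cut_set Z I g k = {z \<in> topspace Z. \<exists>c\<in>{-1..1}. (\<forall>i\<in>I. g i z \<noteq> c) \<and> card {i \<in> I. c < g i z} = k}"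

text \<open>The angle is \<open>0\<close> for the \<open>k\<close> largest values and \<open>pi\<close> for the others. Stating this through ranks avoids a choice of the
level.\<close>

definition cut_angle :: "'i set \<Rightarrow> ('i \<Rightarrow> 'z \<Rightarrow> real) \<Rightarrow> nat \<Rightarrow> 'i \<Rightarrow> 'z \<Rightarrow> real" where
  "cut_angle I g k i z = (if card {i' \<in> I. g i z < g i' z} < k then 0 else pi)"

lemma cut_angle_eq:
  assumes "finite I" "i \<in> I" "\<forall>i\<in>I. g i z \<noteq> c" "card {i \<in> I. c < g i z} = k"
  shows "cut_angle I g k i z = (if c < g i z then 0 else pi)"
proof (cases "c < g i z")
  case True
  then have "{i' \<in> I. g i z < g i' z} \<subset> {i \<in> I. c < g i z}" using assms(2) by auto
  then have "card {i' \<in> I. g i z < g i' z} < k"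
    using psubset_card_mono[of "{i \<in> I. c < g i z}"] assms(1,4) by auto
  then show ?thesis using True by (simp add: cut_angle_def)
next
  case False
  then have "g i z < c" using assms(2,3) by force
  then have "{i \<in> I. c < g i z} \<subseteq> {i' \<in> I. g i z < g i' z}" by auto
  then have "k \<le> card {i' \<in> I. g i z < g i' z}"
    using card_mono[of "{i' \<in> I. g i z < g i' z}"] assms(1,4) by auto
  then show ?thesis using False by (simp add: cut_angle_def)
qed

lemma cut_angle_cases:
  assumes "finite I" "i \<in> I" "z \<in> cut_set Z I g k"
  shows "cut_angle I g k i z = 0 \<and> -1 < g i z \<or> cut_angle I g k i z = pi \<and> g i z < 1"
proof -
  obtain c where c: "c \<in> {-1..1}" "\<forall>i\<in>I. g i z \<noteq> c" "card {i \<in> I. c < g i z} = k"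
    using assms(3) by (auto simp: cut_set_def)
  have "g i z \<noteq> c" using c(2) assms(2) by blast
  then show ?thesis using cut_angle_eq[of I i g z c k, OF assms(1,2) c(2,3)] c(1) by auto
qed

text \<open>Finitely many values cannot exhaust the interval of admissible levels.\<close>

lemma cut_set_covers:
  assumes "finite I" "z \<in> topspace Z"
  shows "\<exists>k\<le>card I. z \<in> cut_set Z I g k"
proof -
  have "infinite ({-1..1::real} - (\<lambda>i. g i z) ` I)"
    using assms(1) infinite_Icc[of "-1::real" 1] by (intro Diff_infinite_finite) auto
  then obtain c where c: "c \<in> {-1..1} - (\<lambda>i. g i z) ` I"
    using infinite_imp_nonempty by blast
  then have "\<forall>i\<in>I. g i z \<noteq> c" by blast
  then have "z \<in> cut_set Z I g (card {i \<in> I. c < g i z})"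
    using c assms(2) unfolding cut_set_def by blast
  moreover have "card {i \<in> I. c < g i z} \<le> card I" using assms(1) by (intro card_mono) auto
  ultimately show ?thesis by blast
qed

text \<open>On a cut set the indices of the values above the level are locally constant: two levels with equally many values above
them have the same values above them. So the set is open, and the angles on it are locally constant.\<close>

lemma
  fixes g :: "'i \<Rightarrow> 'z \<Rightarrow> real"
  assumes I: "finite I" and g: "\<And>i. i \<in> I \<Longrightarrow> continuous_map Z euclideanreal (g i)"
  shows openin_cut_set: "openin Z (cut_set Z I g k)"
    and continuous_map_cut_angle:
      "\<And>i. i \<in> I \<Longrightarrow> continuous_map (subtopology Z (cut_set Z I g k)) euclideanreal (cut_angle I g k i)"
proof -
  define B where "B p = {z \<in> topspace Z. \<forall>i\<in>I. if i \<in> snd p then g i z \<in> {fst p<..} else g i z \<in> {..<fst p}}"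
    for p :: "real \<times> 'i set"
  define K where "K = {p. fst p \<in> {-1..1::real} \<and> snd p \<subseteq> I \<and> card (snd p) = k}"
  have B: "openin Z (B p)" for p
  proof -
    have "openin Z {z \<in> topspace Z. if i \<in> snd p then g i z \<in> {fst p<..} else g i z \<in> {..<fst p}}"
      if "i \<in> I" for i
      using openin_continuous_map_preimage[OF g[OF that], of "{fst p<..}"]
        openin_continuous_map_preimage[OF g[OF that], of "{..<fst p}"]
      by (cases "i \<in> snd p") (simp_all add: open_openin[symmetric])
    then have "openin Z (topspace Z \<inter> (\<Inter>i\<in>I. {z \<in> topspace Z. if i \<in> snd p then g i z \<in> {fst p<..} else g i z \<in> {..<fst p}}))"
      using I by (intro openin_Int_Inter) auto
    moreover have "B p = topspace Z \<inter> (\<Inter>i\<in>I. {z \<in> topspace Z. if i \<in> snd p then g i z \<in> {fst p<..} else g i z \<in> {..<fst p}})"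
      by (auto simp: B_def)
    ultimately show ?thesis by simp
  qed
  have BJ: "{i \<in> I. fst p < g i z} = snd p" "\<forall>i\<in>I. g i z \<noteq> fst p" if "z \<in> B p" "p \<in> K" for p z
    using that by (force simp: B_def K_def split: if_splits)+
  have eq: "cut_set Z I g k = (\<Union>p\<in>K. B p)"
  proof (intro equalityI subsetI)
    fix z assume "z \<in> cut_set Z I g k"
    then obtain c where c: "z \<in> topspace Z" "c \<in> {-1..1}" "\<forall>i\<in>I. g i z \<noteq> c" "card {i \<in> I. c < g i z} = k"
      by (auto simp: cut_set_def)
    then have "(c, {i \<in> I. c < g i z}) \<in> K" by (auto simp: K_def)
    moreover have "z \<in> B (c, {i \<in> I. c < g i z})"
      using c by (force simp: B_def)
    ultimately show "z \<in> (\<Union>p\<in>K. B p)" by blast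
  next
    fix z assume "z \<in> (\<Union>p\<in>K. B p)"
    then obtain p where p: "p \<in> K" "z \<in> B p" by blast
    then show "z \<in> cut_set Z I g k"
      using BJ[OF p(2,1)] by (auto simp: cut_set_def K_def B_def)
  qed
  show "openin Z (cut_set Z I g k)" unfolding eq using B by auto
  show "continuous_map (subtopology Z (cut_set Z I g k)) euclideanreal (cut_angle I g k i)" if i: "i \<in> I" for i
  proof (rule pasting_lemma[where I = K and T = B and f = "\<lambda>p z. if i \<in> snd p then 0 else pi"])
    have ang: "cut_angle I g k i z = (if i \<in> snd p then 0 else pi)" if "p \<in> K" "z \<in> B p" for p z
    proof -
      have "card {i \<in> I. fst p < g i z} = k" using BJ(1)[OF that(2,1)] that(1) by (simp add: K_def)
      from cut_angle_eq[of I i g z "fst p" k, OF I i BJ(2)[OF that(2,1)] this]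
      show ?thesis using BJ(1)[OF that(2,1)] i by auto
    qed
    show "openin (subtopology Z (cut_set Z I g k)) (B p)" if "p \<in> K" for p
      unfolding openin_subtopology using B[of p] that eq by (intro exI[of _ "B p"]) blast
    show "continuous_map (subtopology (subtopology Z (cut_set Z I g k)) (B p)) euclideanreal
        (\<lambda>z. if i \<in> snd p then 0 else pi)" for p
      by simp
    show "(if i \<in> snd p then 0 else pi) = (if i \<in> snd p' then 0 else pi)"
      if "p \<in> K" "p' \<in> K" "z \<in> topspace (subtopology Z (cut_set Z I g k)) \<inter> B p \<inter> B p'" for p p' z
      using that ang[of p z] ang[of p' z] by simp
    show "\<exists>p. p \<in> K \<and> z \<in> B p \<and> cut_angle I g k i z = (if i \<in> snd p then 0 else pi)"
      if z: "z \<in> topspace (subtopology Z (cut_set Z I g k))" for z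
    proof -
      obtain p where "p \<in> K" "z \<in> B p" using z eq by auto
      then show ?thesis using ang by blast
    qed
  qed
qed

section \<open>Motion planners on the generalized projective product spaces\<close>

definition first :: "(nat \<Rightarrow> nat \<Rightarrow> complex) \<Rightarrow> nat \<Rightarrow> nat \<Rightarrow> complex" where
  "first x = restrict x {0}"

lemma first_in:
  assumes "ns \<noteq> []" and "x \<in> topspace (sphere_product ns)"
  shows "first x \<in> topspace (sphere_product [ns ! 0])"
  using assms by (auto simp: in_sphere_product first_def)

lemma first_rotate_by: "ns \<noteq> [] \<Longrightarrow> first (rotate_by ns w x) = rotate_by [m] w (first x)"
  by (auto simp: first_def rotate_by_def fun_eq_iff restrict_def)

lemma continuous_map_first:
  assumes "ns \<noteq> []"
  shows "continuous_map (sphere_product ns) (sphere_product [ns ! 0]) first"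
  unfolding continuous_map_into_sphere_product
  using assms by (auto simp: first_in) (auto simp: first_def intro!: continuous_map_coordinate)

text \<open>The construction of the planners. On pairs of representatives over \<open>U\<close>, the lift \<open>L\<close> moves the first coordinate, its
end determines \<open>\<phi>\<close>, and the function \<open>g i\<close> decides which rule moves the coordinate \<open>x i\<close> to \<open>\<phi> y i\<close> for \<open>i \<ge> 1\<close>.\<close>

lemma refine_motion_planner:
  assumes t: "0 < t" and ns: "ns \<noteq> []"
    and U: "openin (prod_topology (CP_space [ns ! 0] t) (CP_space [ns ! 0] t)) U"
    and planner: "has_motion_planner (CP_space [ns ! 0] t) U"
  obtains V where "\<And>k. openin (prod_topology (CP_space ns t) (CP_space ns t)) (V k)"
    and "\<And>k. has_motion_planner (CP_space ns t) (V k)"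
    and "\<And>x y. \<lbrakk>x \<in> topspace (sphere_product ns); y \<in> topspace (sphere_product ns);
           (orb [ns ! 0] t (first x), orb [ns ! 0] t (first y)) \<in> U\<rbrakk>
          \<Longrightarrow> \<exists>k<length ns. (orb ns t x, orb ns t y) \<in> V k"
proof -
  let ?P = "sphere_product ns" and ?Q = "CP_space ns t"
  let ?A = "sphere_product [ns ! 0]" and ?B = "CP_space [ns ! 0] t" and ?o = "orb [ns ! 0] t"
  let ?r = "length ns" and ?unit = "top_of_set {0..1::real}"
  interpret tr: transport ?A ?B ?o "orbit_gap [ns ! 0] t" "nearest_lift [ns ! 0] t"
    by (rule transport_orb[OF t]) simp
  have r: "0 < ?r" using ns by simp
  obtain s where s: "continuous_map (subtopology (prod_topology ?B ?B) U) (path_space ?B) s"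
    "\<And>c. c \<in> U \<Longrightarrow> path_fibration (s c) = c"
    using planner by (auto simp: has_motion_planner_def)
  define e where "e p = (?o (first (fst p)), ?o (first (snd p)))" for p
  define D where "D = {p \<in> topspace (prod_topology ?P ?P). e p \<in> U}"
  define Z where "Z = subtopology (prod_topology ?P ?P) D"
  have topZ: "topspace Z = D" by (auto simp: Z_def D_def)
  have e: "continuous_map (prod_topology ?P ?P) (prod_topology ?B ?B) e"
    unfolding e_def
    using continuous_map_compose[OF continuous_map_fst
        continuous_map_compose[OF continuous_map_first[OF ns] continuous_map_orb]]
      continuous_map_compose[OF continuous_map_snd
        continuous_map_compose[OF continuous_map_first[OF ns] continuous_map_orb]]
    by (intro continuous_map_pairedI) (simp_all add: o_def)
  have D: "openin (prod_topology ?P ?P) D"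
    unfolding D_def by (rule openin_continuous_map_preimage[OF e U])
  have D_in: "fst p \<in> topspace ?P" "snd p \<in> topspace ?P" "e p \<in> U" if "p \<in> D" for p
    using that by (auto simp: D_def)
  have "continuous_map Z (subtopology (prod_topology ?B ?B) U) e"
    unfolding Z_def continuous_map_in_subtopology
    using continuous_map_from_subtopology[OF e] by (auto simp: D_def)
  from continuous_map_compose[OF this s(1)]
  have se: "continuous_map Z (path_space ?B) (\<lambda>p. s (e p))" by (simp add: o_def)
  then have H: "continuous_map (prod_topology Z ?unit) ?B (\<lambda>p. s (e (fst p)) (snd p))"
    by (rule continuous_map_eval_path_space)
  have path: "pathin ?B (s (e p))" "s (e p) 0 = ?o (first (fst p))" "s (e p) 1 = ?o (first (snd p))"
    if p: "p \<in> D" for p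
  proof -
    show "pathin ?B (s (e p))"
      using continuous_map_image_subset_topspace[OF se] p by (auto simp: topZ topspace_path_space)
    show "s (e p) 0 = ?o (first (fst p))" "s (e p) 1 = ?o (first (snd p))"
      using s(2)[OF D_in(3)[OF p]] by (auto simp: path_fibration_def e_def)
  qed
  have coord: "continuous_map (prod_topology ?P ?P) euclidean (\<lambda>p. fst p i j)"
    "continuous_map (prod_topology ?P ?P) euclidean (\<lambda>p. snd p i j)" if "i < ?r" for i j
    using continuous_map_compose[OF continuous_map_fst continuous_map_coordinate[OF that]]
      continuous_map_compose[OF continuous_map_snd continuous_map_coordinate[OF that]]
    by (simp_all add: o_def)
  then have coordZ: "continuous_map Z euclidean (\<lambda>p. fst p i j)"
    "continuous_map Z euclidean (\<lambda>p. snd p i j)" if "i < ?r" for i j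
    using that by (simp_all add: Z_def continuous_map_from_subtopology)

  \<comment> \<open>The lift to the first sphere of the path that the given planner chooses.\<close>
  define L where "L p = tr.lift (first (fst p)) (s (e p))" for p
  have L: "L p \<tau> \<in> topspace ?A" "?o (L p \<tau>) = s (e p) \<tau>" if p: "p \<in> D" "\<tau> \<in> {0..1}" for p \<tau>
    unfolding L_def
    using tr.lift_in[OF path(1)[OF p(1)] first_in[OF ns D_in(1)[OF p(1)]] path(2)[OF p(1), symmetric] p(2)]
      tr.q_lift[OF path(1)[OF p(1)] first_in[OF ns D_in(1)[OF p(1)]] path(2)[OF p(1), symmetric] p(2)]
    by auto
  have L0: "L p 0 = first (fst p)" if "p \<in> D" for p
    using that unfolding L_def by (intro tr.lift_0 path first_in ns D_in) (auto simp: path)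
  have L_cont: "continuous_map (prod_topology Z ?unit) ?A (\<lambda>p. L (fst p) (snd p))"
    unfolding L_def
  proof (rule tr.continuous_map_lift[OF H])
    show "continuous_map Z ?A (\<lambda>p. first (fst p))"
      unfolding Z_def
      using continuous_map_compose[OF continuous_map_fst continuous_map_first[OF ns]]
      by (intro continuous_map_from_subtopology) (simp add: o_def)
  qed (simp add: topZ path)
  have L_coord: "continuous_map (prod_topology Z ?unit) euclidean (\<lambda>p. L (fst p) (snd p) 0 j)" for j
    using continuous_map_compose[OF L_cont continuous_map_coordinate[of 0 "[ns ! 0]" j]]
    by (simp add: o_def)

  \<comment> \<open>The inner product with the unit vector \<open>y 0\<close> recovers the factor by which the end of the lift differs from it.\<close>
  define \<phi> where "\<phi> p = herm (ns ! 0) (L p 1 0) (snd p 0)" for p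
  have \<phi>: "\<phi> p \<in> root_group t" "L p 1 = rotate_by [ns ! 0] (\<phi> p) (first (snd p))" if p: "p \<in> D" for p
  proof -
    have "?o (first (snd p)) = ?o (L p 1)" using L(2)[OF p, of 1] path(3)[OF p] by simp
    then obtain w where w: "w \<in> root_group t" "L p 1 = rotate_by [ns ! 0] w (first (snd p))"
      using orb_eq_iff[OF first_in[OF ns D_in(2)[OF p]] L(1)[OF p, of 1]] by auto
    have "L p 1 0 = (\<lambda>j. w * snd p 0 j)" by (simp add: w(2) rotate_by_def first_def)
    then have "\<phi> p = w"
      using herm_self_sphere[OF D_in(2)[OF p] r] by (simp add: \<phi>_def herm_scale_left)
    with w show "\<phi> p \<in> root_group t" "L p 1 = rotate_by [ns ! 0] (\<phi> p) (first (snd p))" by auto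
  qed
  have "continuous_map Z (prod_topology Z ?unit) (\<lambda>p. (p, 1))"
    by (intro continuous_map_pairedI) auto
  from continuous_map_compose[OF this L_coord]
  have L1: "continuous_map Z euclidean (\<lambda>p. L p 1 0 j)" for j by (simp add: o_def)
  have \<phi>_cont: "continuous_map Z euclidean \<phi>"
    unfolding \<phi>_def by (intro continuous_map_herm L1 coordZ r)

  \<comment> \<open>At \<open>u = - 1\<close>, where \<open>\<theta> = 0\<close> fails, the value is \<open>- 1\<close>; at \<open>u = - \<i>\<close>, where \<open>\<theta> = pi\<close> fails, it is \<open>1\<close>.\<close>
  define g where "g i p = (let u = herm (ns ! i) (fst p i) (\<lambda>j. \<phi> p * snd p i j) in Re u - Im u)" for i p
  let ?I = "{1..<?r}"
  have g_cont: "continuous_map Z euclideanreal (g i)" if i: "i \<in> ?I" for i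
  proof -
    have "continuous_map Z euclidean (\<lambda>p. herm (ns ! i) (fst p i) (\<lambda>j. \<phi> p * snd p i j))"
      using i by (intro continuous_map_herm continuous_map_complex_mult coordZ \<phi>_cont) auto
    from continuous_map_unary_op[OF this, of UNIV "\<lambda>u. Re u - Im u"]
    show ?thesis unfolding g_def[abs_def] Let_def by (simp add: continuous_intros)
  qed
  define W where "W k = cut_set Z ?I g k" for k
  have WD: "W k \<subseteq> D" for k by (auto simp: W_def cut_set_def topZ)
  have W: "openin (prod_topology ?P ?P) (W k)" for k
    using openin_cut_set[of ?I Z g k] g_cont D by (auto simp: W_def Z_def openin_open_subtopology)
  define Zk where "Zk k = subtopology (prod_topology ?P ?P) (W k)" for k
  have Zk: "Zk k = subtopology Z (W k)" for k
    using WD[of k] by (simp add: Zk_def Z_def subtopology_subtopology Int_absorb1)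
  have topZk: "topspace (Zk k) = W k" for k
    using WD[of k] by (auto simp: Zk topZ)
  define \<theta> where "\<theta> k i p = cut_angle ?I g k i p" for k i p
  define \<Gamma> where "\<Gamma> k p \<tau> = (\<lambda>i\<in>{..<?r}. if i = 0 then L p \<tau> 0
      else sphere_path (ns ! i) (\<theta> k i p) (fst p i) (\<lambda>j. \<phi> p * snd p i j) \<tau>)" for k p \<tau>

  have unit_x: "(\<Sum>j\<le>ns ! i. (cmod (fst p i j))\<^sup>2) = 1" and
    unit_y: "(\<Sum>j\<le>ns ! i. (cmod (\<phi> p * snd p i j))\<^sup>2) = 1"
    if "p \<in> D" "i < ?r" for p i
    using D_in(1,2)[OF that(1)] that(2) root_groupD[OF \<phi>(1)[OF that(1)]]
    by (auto simp: in_sphere_product norm_mult)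
  have pos: "0 < (\<Sum>j\<le>ns ! i. (cmod (blend (\<theta> k i p) (fst p i) (\<lambda>j. \<phi> p * snd p i j) \<tau> j))\<^sup>2)"
    if p: "p \<in> W k" and i: "i \<in> ?I" and \<tau>: "\<tau> \<in> {0..1}" for k p i \<tau>
  proof (rule blend_nonzero[OF _ _ \<tau>])
    have "p \<in> D" "i < ?r" using WD p i by auto
    then show "(\<Sum>j\<le>ns ! i. (cmod (fst p i j))\<^sup>2) = 1" "(\<Sum>j\<le>ns ! i. (cmod (\<phi> p * snd p i j))\<^sup>2) = 1"
      using unit_x unit_y by auto
    have "\<theta> k i p = 0 \<and> -1 < g i p \<or> \<theta> k i p = pi \<and> g i p < 1"
      unfolding \<theta>_def using p i by (intro cut_angle_cases) (auto simp: W_def)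
    then show "herm (ns ! i) (fst p i) (\<lambda>j. \<phi> p * snd p i j) \<noteq> - cis (\<theta> k i p / 2)"
      by (auto simp: g_def Let_def)
  qed

  have \<Gamma>_in: "\<Gamma> k p \<tau> \<in> topspace ?P" if p: "p \<in> W k" and \<tau>: "\<tau> \<in> {0..1}" for k p \<tau>
  proof -
    have pD: "p \<in> D" using WD p by auto
    have "(\<Sum>j\<le>ns ! i. (cmod (\<Gamma> k p \<tau> i j))\<^sup>2) = 1 \<and> (\<forall>j>ns ! i. \<Gamma> k p \<tau> i j = 0)" if i: "i < ?r" for i
    proof (cases "i = 0")
      case True
      then show ?thesis using L(1)[OF pD \<tau>] i by (simp add: \<Gamma>_def in_sphere_product)
    next
      case False
      then have "i \<in> ?I" using i by auto
      moreover have "fst p i j = 0" "snd p i j = 0" if "j > ns ! i" for j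
        using D_in(1,2)[OF pD] i that by (auto simp: in_sphere_product)
      ultimately show ?thesis
        using sphere_path_unit[OF pos[OF p _ \<tau>]] i False
        by (simp add: \<Gamma>_def) (simp add: sphere_path_def blend_def)
    qed
    then show ?thesis by (simp add: in_sphere_product) (simp add: \<Gamma>_def)
  qed
  have \<Gamma>_cont: "continuous_map (prod_topology (Zk k) ?unit) ?P (\<lambda>p. \<Gamma> k (fst p) (snd p))" for k
    unfolding continuous_map_into_sphere_product
  proof (intro conjI ballI allI impI)
    fix p assume "p \<in> topspace (prod_topology (Zk k) ?unit)"
    then show "\<Gamma> k (fst p) (snd p) \<in> topspace ?P" by (intro \<Gamma>_in) (auto simp: topZk)
  next
    fix i j assume i: "i < ?r"
    let ?S = "prod_topology (Zk k) ?unit"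
    have from_Z: "continuous_map ?S euclidean (\<lambda>p. f (fst p))" if "continuous_map Z euclidean f"
      for f :: "_ \<Rightarrow> complex"
      using continuous_map_compose[OF continuous_map_fst continuous_map_from_subtopology[OF that, of "W k"]]
      by (simp add: Zk o_def)
    have sub: "?S = subtopology (prod_topology Z ?unit) (W k \<times> topspace ?unit)"
      unfolding Zk by (rule prod_topology_subtopology)
    show "continuous_map ?S euclidean (\<lambda>p. \<Gamma> k (fst p) (snd p) i j)"
    proof (cases "i = 0")
      case True
      then show ?thesis
        using i L_coord[of j] by (simp add: \<Gamma>_def sub continuous_map_from_subtopology)
    next
      case False
      then have iI: "i \<in> ?I" using i by auto
      have "continuous_map (Zk k) euclideanreal (\<theta> k i)"
        unfolding \<theta>_def Zk W_def using g_cont iI by (intro continuous_map_cut_angle) auto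
      from continuous_map_compose[OF continuous_map_fst this]
      have \<theta>: "continuous_map ?S euclideanreal (\<lambda>p. \<theta> k i (fst p))" by (simp add: o_def)
      have \<tau>: "continuous_map ?S euclideanreal snd"
        using continuous_map_snd[of "Zk k" ?unit] by (simp add: continuous_map_in_subtopology)
      have "continuous_map ?S euclidean (\<lambda>p. sphere_path (ns ! i) (\<theta> k i (fst p)) (fst (fst p) i)
          (\<lambda>j. \<phi> (fst p) * snd (fst p) i j) (snd p) j)"
        using i iI
        by (intro continuous_map_sphere_path \<theta> \<tau> continuous_map_complex_mult
            from_Z[OF coordZ(1)] from_Z[OF coordZ(2)] from_Z[OF \<phi>_cont] pos) (auto simp: topZk)
      then show ?thesis using i False by (simp add: \<Gamma>_def)
    qed
  qed

  \<comment> \<open>If \<open>x\<close> and \<open>y\<close> are rotated by \<open>v\<close> and \<open>w\<close>, then \<open>\<phi>\<close> is multiplied by \<open>v * cnj w\<close>, so that \<open>\<phi> y\<close> is rotated by \<open>v\<close>.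
    Hence the functions \<open>g i\<close> do not change and the whole path is rotated by \<open>v\<close>.\<close>
  have moved: "(x', y') \<in> W k \<and> (\<forall>\<tau>\<in>{0..1}. orb ns t (\<Gamma> k (x', y') \<tau>) = orb ns t (\<Gamma> k (x, y) \<tau>))"
    if p: "(x, y) \<in> W k" and x': "x' \<in> topspace ?P" "orb ns t x' = orb ns t x"
      and y': "y' \<in> topspace ?P" "orb ns t y' = orb ns t y" for k x y x' y'
  proof -
    let ?p = "(x, y)" and ?p' = "(x', y')"
    have pD: "?p \<in> D" using WD p by auto
    have xy: "x \<in> topspace ?P" "y \<in> topspace ?P" using D_in[OF pD] by auto
    obtain v where v: "v \<in> root_group t" "x' = rotate_by ns v x"
      using orb_eq_iff[OF xy(1) x'(1), of t] x'(2) by auto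
    obtain w where w: "w \<in> root_group t" "y' = rotate_by ns w y"
      using orb_eq_iff[OF xy(2) y'(1), of t] y'(2) by auto
    have fx: "first x' = rotate_by [ns ! 0] v (first x)" and fy: "first y' = rotate_by [ns ! 0] w (first y)"
      by (simp_all add: v w first_rotate_by[OF ns, of _ _ "ns ! 0"])
    have e': "e ?p' = e ?p"
      using first_in[OF ns xy(1)] first_in[OF ns xy(2)] v(1) w(1)
      by (simp add: e_def fx fy orb_rotate_by)
    have p'D: "?p' \<in> D" using pD x' y' e' by (simp add: D_def)
    have L': "L ?p' \<tau> = rotate_by [ns ! 0] v (L ?p \<tau>)" if \<tau>: "\<tau> \<in> {0..1}" for \<tau>
      unfolding L_def e' fst_conv fx
      using path[OF pD] first_in[OF ns xy(1)] v(1) \<tau>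
      by (intro tr.lift_equivariant nearest_lift_rotate_by) auto
    have \<phi>': "\<phi> ?p' = v * cnj w * \<phi> ?p"
      using r L'[of 1] by (simp add: \<phi>_def rotate_by_def w(2) herm_scale_left herm_scale_right mult_ac)
    have y'_scaled: "(\<lambda>j. \<phi> ?p' * y' i j) = (\<lambda>j. v * (\<phi> ?p * y i j))" if "i < ?r" for i
    proof
      fix j
      have "\<phi> ?p' * y' i j = v * (\<phi> ?p * y i j) * (cnj w * w)"
        using that unfolding \<phi>' by (simp add: w(2) rotate_by_def mult_ac)
      then show "\<phi> ?p' * y' i j = v * (\<phi> ?p * y i j)" by (simp add: cnj_mult_root_group[OF w(1)])
    qed
    have x'_scaled: "x' i = (\<lambda>j. v * x i j)" if "i < ?r" for i
      using that by (simp add: v(2) rotate_by_def)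
    have g': "g i ?p' = g i ?p" if "i \<in> ?I" for i
    proof -
      have i: "i < ?r" using that by simp
      have "herm (ns ! i) (x' i) (\<lambda>j. \<phi> ?p' * y' i j) = cnj v * v * herm (ns ! i) (x i) (\<lambda>j. \<phi> ?p * y i j)"
        unfolding y'_scaled[OF i] x'_scaled[OF i] herm_scale_left herm_scale_right by (simp only: mult_ac)
      then show ?thesis by (simp add: g_def cnj_mult_root_group[OF v(1)])
    qed
    have cut: "{i \<in> ?I. c < g i ?p'} = {i \<in> ?I. c < g i ?p}"
      "(\<forall>i\<in>?I. g i ?p' \<noteq> c) = (\<forall>i\<in>?I. g i ?p \<noteq> c)" for c
      using g' by auto
    have "?p' \<in> W k"
      using p pD p'D by (simp only: W_def cut_set_def cut topZ mem_Collect_eq)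
    moreover have "orb ns t (\<Gamma> k ?p' \<tau>) = orb ns t (\<Gamma> k ?p \<tau>)" if \<tau>: "\<tau> \<in> {0..1}" for \<tau>
    proof -
      have \<theta>': "\<theta> k i ?p' = \<theta> k i ?p" if i: "i \<in> ?I" for i
      proof -
        have "{i' \<in> ?I. g i ?p' < g i' ?p'} = {i' \<in> ?I. g i ?p < g i' ?p}" using g' i by auto
        then show ?thesis by (simp only: \<theta>_def cut_angle_def)
      qed
      have "\<Gamma> k ?p' \<tau> i = (\<lambda>j. v * \<Gamma> k ?p \<tau> i j)" if i: "i < ?r" for i
      proof (cases "i = 0")
        case True
        then show ?thesis using r L'[OF \<tau>] by (simp add: \<Gamma>_def rotate_by_def)
      next
        case False
        then have "i \<in> ?I" using i by auto
        then show ?thesis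
          using i False \<theta>'[of i] sphere_path_equivariant[OF root_groupD[OF v(1)]]
          by (simp add: \<Gamma>_def y'_scaled x'_scaled)
      qed
      then have "\<Gamma> k ?p' \<tau> = rotate_by ns v (\<Gamma> k ?p \<tau>)"
        by (auto simp: rotate_by_def fun_eq_iff restrict_def) (simp add: \<Gamma>_def)
      then show ?thesis using orb_rotate_by[OF \<Gamma>_in[OF p \<tau>] v(1)] by simp
    qed
    ultimately show ?thesis by blast
  qed

  define V where "V k = (\<lambda>p. (orb ns t (fst p), orb ns t (snd p))) ` W k" for k
  have ends: "orb ns t (\<Gamma> k (x, y) 0) = orb ns t x \<and> orb ns t (\<Gamma> k (x, y) 1) = orb ns t y"
    if p: "(x, y) \<in> W k" for k x y
  proof -
    let ?p = "(x, y)"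
    have pD: "?p \<in> D" using WD p by auto
    have xy: "x \<in> topspace ?P" "y \<in> topspace ?P" using D_in[OF pD] by auto
    have "\<Gamma> k ?p 0 i = x i" if "i < ?r" for i
      using that L0[OF pD] unit_x[OF pD that] by (simp add: \<Gamma>_def first_def sphere_path_0)
    then have "\<Gamma> k ?p 0 = x"
      using xy(1) by (auto simp: fun_eq_iff in_sphere_product extensional_def) (simp add: \<Gamma>_def)
    moreover have "\<Gamma> k ?p 1 i = (\<lambda>j. \<phi> ?p * y i j)" if "i < ?r" for i
      using that \<phi>(2)[OF pD] unit_y[OF pD that]
      by (simp add: \<Gamma>_def first_def rotate_by_def sphere_path_1)
    then have "\<Gamma> k ?p 1 = rotate_by ns (\<phi> ?p) y"
      by (auto simp: rotate_by_def fun_eq_iff restrict_def) (simp add: \<Gamma>_def)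
    ultimately show ?thesis using orb_rotate_by[OF xy(2) \<phi>(1)[OF pD]] by simp
  qed
  have h: "continuous_map (prod_topology (subtopology (prod_topology ?P ?P) (W k)) ?unit) ?Q
      (\<lambda>p. orb ns t (\<Gamma> k (fst p) (snd p)))" for k
    using continuous_map_compose[OF \<Gamma>_cont continuous_map_orb] by (simp add: o_def Zk_def)
  note descend = motion_planner_descends[OF quotient_map_orb open_map_orb W h ends]
  show thesis
  proof (rule that)
    show "openin (prod_topology ?Q ?Q) (V k)" "has_motion_planner ?Q (V k)" for k
      unfolding V_def using moved by (intro descend; blast)+
    show "\<exists>k<?r. (orb ns t x, orb ns t y) \<in> V k"
      if "x \<in> topspace ?P" "y \<in> topspace ?P" "(?o (first x), ?o (first y)) \<in> U" for x y
    proof -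
      have "(x, y) \<in> topspace Z" using that by (simp add: topZ D_def e_def)
      then obtain k where k: "k \<le> card ?I" "(x, y) \<in> W k"
        using cut_set_covers[of ?I "(x, y)" Z g] by (auto simp: W_def)
      have "card ?I < ?r" using r by simp
      then have "k < ?r" using k(1) by linarith
      then show ?thesis using k(2) by (force simp: V_def)
    qed
  qed
qed

theorem theorem4p1:
  fixes t :: enat and ns :: "nat list"
  assumes "0 < t" and "ns \<noteq> []" and "sorted ns"
  shows "TC (CP_space ns t) \<le> enat (length ns) * (1 + TC (CP_space [ns ! 0] t)) - 1"
proof (cases "TC (CP_space [ns ! 0] t)")
  case infinity
  have "enat (length ns) * \<infinity> = \<infinity>" using assms(2) by (simp add: imult_is_infinity zero_enat_def)
  then show ?thesis by (simp add: infinity)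
next
  case (enat m)
  let ?Q = "CP_space ns t" and ?B = "CP_space [ns ! 0] t" and ?r = "length ns"
  obtain U where U: "\<And>a. a \<le> m \<Longrightarrow> openin (prod_topology ?B ?B) (U a) \<and> has_motion_planner ?B (U a)"
    and cover: "(\<Union>a\<le>m. U a) = topspace (prod_topology ?B ?B)"
    using TC_attained[OF enat] by metis
  have "\<exists>V. (\<forall>k. openin (prod_topology ?Q ?Q) (V k) \<and> has_motion_planner ?Q (V k)) \<and>
      (\<forall>x\<in>topspace (sphere_product ns). \<forall>y\<in>topspace (sphere_product ns).
         (orb [ns ! 0] t (first x), orb [ns ! 0] t (first y)) \<in> U a \<longrightarrow>
         (\<exists>k<?r. (orb ns t x, orb ns t y) \<in> V k))" if "a \<le> m" for a
    using refine_motion_planner[OF assms(1,2), of "U a"] U[OF that] by metis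
  then obtain V where V: "\<And>a k. a \<le> m \<Longrightarrow> openin (prod_topology ?Q ?Q) (V a k) \<and> has_motion_planner ?Q (V a k)"
    and V_cover: "\<And>a x y. \<lbrakk>a \<le> m; x \<in> topspace (sphere_product ns); y \<in> topspace (sphere_product ns);
         (orb [ns ! 0] t (first x), orb [ns ! 0] t (first y)) \<in> U a\<rbrakk>
         \<Longrightarrow> \<exists>k<?r. (orb ns t x, orb ns t y) \<in> V a k"
    by metis
  define N where "N = ?r * (1 + m) - 1"
  have r: "0 < ?r" using assms(2) by simp
  have N: "l \<le> N \<longleftrightarrow> l < (1 + m) * ?r" for l
  proof -
    have "l \<le> b - 1 \<longleftrightarrow> l < b" if "0 < b" for b :: nat using that by auto
    then show ?thesis unfolding N_def mult.commute[of ?r] using r by simp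
  qed
  \<comment> \<open>The pairs \<open>(a, k)\<close> with \<open>a \<le> m\<close> and \<open>k < r\<close> are enumerated by \<open>a * r + k\<close>.\<close>
  define V' where "V' l = V (l div ?r) (l mod ?r)" for l
  have "l div ?r \<le> m" if "l \<le> N" for l
    using that r N less_mult_imp_div_less[of l "1 + m" ?r] by simp
  then have "\<forall>l\<le>N. openin (prod_topology ?Q ?Q) (V' l) \<and> has_motion_planner ?Q (V' l)"
    using V by (simp add: V'_def)
  moreover have "(\<Union>l\<le>N. V' l) = topspace (prod_topology ?Q ?Q)"
  proof
    show "(\<Union>l\<le>N. V' l) \<subseteq> topspace (prod_topology ?Q ?Q)"
      using calculation openin_subset by blast
    show "topspace (prod_topology ?Q ?Q) \<subseteq> (\<Union>l\<le>N. V' l)"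
    proof
      fix c assume "c \<in> topspace (prod_topology ?Q ?Q)"
      then obtain x y where xy: "x \<in> topspace (sphere_product ns)" "y \<in> topspace (sphere_product ns)"
        "c = (orb ns t x, orb ns t y)"
        by (auto simp: topspace_CP_space)
      have "(orb [ns ! 0] t (first x), orb [ns ! 0] t (first y)) \<in> (\<Union>a\<le>m. U a)"
        using cover first_in[OF assms(2)] xy by (auto simp: topspace_CP_space)
      then obtain a where a: "a \<le> m" "(orb [ns ! 0] t (first x), orb [ns ! 0] t (first y)) \<in> U a" by auto
      obtain k where k: "k < ?r" "c \<in> V a k" using V_cover[OF a(1) xy(1,2) a(2)] xy(3) by auto
      have "a * ?r + k < (1 + a) * ?r" using k by simp
      also have "\<dots> \<le> (1 + m) * ?r" using a by (intro mult_right_mono) auto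
      finally have "a * ?r + k \<le> N" using N by blast
      moreover have "(a * ?r + k) div ?r = a" using k(1) r by simp
      then have "c \<in> V' (a * ?r + k)" using k by (simp add: V'_def)
      ultimately show "c \<in> (\<Union>l\<le>N. V' l)" by blast
    qed
  qed
  ultimately have "TC ?Q \<le> enat N"
    unfolding TC_def by (intro Inf_lower) blast
  then show ?thesis by (simp add: N_def enat one_enat_def)
qed

end
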